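(* Let $m\ge 2$ and let $M^{2m}$ be a Kähler manifold of real dimension $2m$ that is isometrically immersed in a Riemannian manifold whose curvature operator is bounded from below by a constant $c$ such that $H^2+c\ge 0$ on $M^{2m}$. Then $S\ge a\big(2m,2[m/2],H,c\big)$ at every point of $M^{2m}$, where $[m/2]$ denotes the integer part of $m/2$.
   Context: All manifolds are connected and the submanifold is oriented. For an isometric immersion $f$ of an $n$-dimensional Riemannian manifold with second fundamental form $\alpha_f$, $S=\|\alpha_f\|^2$ is the squared length of $\alpha_f$ and $H=\|\mathcal H\|$ is the mean curvature, where $\mathcal H=(\mathrm{tr}\,\alpha_f)/n$ (here $n=2m$). The curvature operator is the self-adjoint operator on $2$-vectors of the ambient manifold normalized so that it equals $c\cdot\mathrm{id}$ in constant sectional curvature $c$; "bounded from below by $c$" means all its eigenvalues are at least $c$. The function $a$ is $$a(n,p,t,c)=nc+\frac{n^3t^2}{2p(n-p)}-\frac{n|n-2p|t}{2p(n-p)}\sqrt{n^2t^2+4p(n-p)c}.$$ *)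

theory Defs
  imports "HOL-Analysis.Analysis"
begin

section \<open>Smooth maps between open subsets of Euclidean spaces\<close>

abbreviation ddir ::
  "('a::real_normed_vector \<Rightarrow> 'b::real_normed_vector) \<Rightarrow> 'a \<Rightarrow> 'a \<Rightarrow> 'b" where
  "ddir f x v \<equiv> frechet_derivative f (at x) v"

text \<open>Both notions are used on open sets \<open>S\<close> of finite-dimensional spaces only.\<close>

primrec Ck_on ::
  "nat \<Rightarrow> ('a::real_normed_vector \<Rightarrow> 'b::real_normed_vector) \<Rightarrow> 'a set \<Rightarrow> bool" where
  "Ck_on 0 f S \<longleftrightarrow> continuous_on S f"
| "Ck_on (Suc k) f S \<longleftrightarrow>
     (\<forall>x\<in>S. f differentiable (at x)) \<and> (\<forall>v. Ck_on k (\<lambda>x. ddir f x v) S)"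

definition smooth_on ::
  "('a::real_normed_vector \<Rightarrow> 'b::real_normed_vector) \<Rightarrow> 'a set \<Rightarrow> bool" where
  "smooth_on f S \<longleftrightarrow> (\<forall>k. Ck_on k f S)"


section \<open>Smooth manifolds\<close>

text \<open>A chart is a pair of its domain and its coordinate map; the values of the coordinate
  map outside the domain are irrelevant.\<close>

type_synonym ('a, 'n) chart = "'a set \<times> ('a \<Rightarrow> (real, 'n) vec)"

definition chart_image :: "('a, 'n::finite) chart \<Rightarrow> (real^'n) set" where
  "chart_image \<kappa> = snd \<kappa> ` fst \<kappa>"

definition chart_inv :: "('a, 'n::finite) chart \<Rightarrow> real^'n \<Rightarrow> 'a" where
  "chart_inv \<kappa> = inv_into (fst \<kappa>) (snd \<kappa>)"

definition local_rep ::
  "('a, 'n::finite) chart \<Rightarrow> ('b, 'k::finite) chart \<Rightarrow> ('a \<Rightarrow> 'b) \<Rightarrow> real^'n \<Rightarrow> real^'k" where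
  "local_rep \<kappa> \<mu> f = snd \<mu> \<circ> f \<circ> chart_inv \<kappa>"

definition local_dom ::
  "('a, 'n::finite) chart \<Rightarrow> ('b, 'k::finite) chart \<Rightarrow> ('a \<Rightarrow> 'b) \<Rightarrow> (real^'n) set" where
  "local_dom \<kappa> \<mu> f = snd \<kappa> ` {p \<in> fst \<kappa>. f p \<in> fst \<mu>}"

definition transition ::
  "('a, 'n::finite) chart \<Rightarrow> ('a, 'n) chart \<Rightarrow> real^'n \<Rightarrow> real^'n" where
  "transition \<kappa> \<kappa>' = local_rep \<kappa> \<kappa>' id"

definition smooth_manifold :: "'a topology \<Rightarrow> ('a, 'n::finite) chart set \<Rightarrow> bool" where
  "smooth_manifold X A \<longleftrightarrow>
     Hausdorff_space X \<and> second_countable X \<and> topspace X = (\<Union>\<kappa>\<in>A. fst \<kappa>) \<and>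
     (\<forall>\<kappa>\<in>A. openin X (fst \<kappa>) \<and> open (chart_image \<kappa>) \<and>
        homeomorphic_map (subtopology X (fst \<kappa>)) (top_of_set (chart_image \<kappa>)) (snd \<kappa>)) \<and>
     (\<forall>\<kappa>\<in>A. \<forall>\<kappa>'\<in>A. smooth_on (transition \<kappa> \<kappa>') (local_dom \<kappa> \<kappa>' id))"

definition oriented_atlas :: "('a, 'n::finite) chart set \<Rightarrow> bool" where
  "oriented_atlas A \<longleftrightarrow>
     (\<forall>\<kappa>\<in>A. \<forall>\<kappa>'\<in>A. \<forall>x\<in>local_dom \<kappa> \<kappa>' id. 0 < det (matrix (ddir (transition \<kappa> \<kappa>') x)))"

definition smooth_map ::
  "'a topology \<Rightarrow> ('a, 'n::finite) chart set \<Rightarrow> 'b topology \<Rightarrow> ('b, 'k::finite) chart set \<Rightarrow>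
   ('a \<Rightarrow> 'b) \<Rightarrow> bool" where
  "smooth_map X A Y B f \<longleftrightarrow>
     continuous_map X Y f \<and>
     (\<forall>\<kappa>\<in>A. \<forall>\<mu>\<in>B. smooth_on (local_rep \<kappa> \<mu> f) (local_dom \<kappa> \<mu> f))"

definition chart_at :: "('a, 'n) chart set \<Rightarrow> 'a \<Rightarrow> ('a, 'n) chart" where
  "chart_at A p = (SOME \<kappa>. \<kappa> \<in> A \<and> p \<in> fst \<kappa>)"


section \<open>Riemannian metrics\<close>

text \<open>A tangent vector at a point is represented in a chart by its components with respect to
  the coordinate frame, and a tensor field by the family of its expressions in the charts of the
  atlas, related by the tensor transformation law.  So \<open>g \<kappa> x u v\<close> is the value of the metric
  at the point with coordinates \<open>x\<close> in \<open>\<kappa>\<close>, on the tangent vectors with components \<open>u\<close> and \<open>v\<close>.\<close>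

definition riemannian_metric ::
  "('a, 'n::finite) chart set \<Rightarrow>
   (('a, 'n) chart \<Rightarrow> real^'n \<Rightarrow> real^'n \<Rightarrow> real^'n \<Rightarrow> real) \<Rightarrow> bool" where
  "riemannian_metric A g \<longleftrightarrow>
     (\<forall>\<kappa>\<in>A.
        (\<forall>x\<in>chart_image \<kappa>. bilinear (g \<kappa> x) \<and> (\<forall>u v. g \<kappa> x u v = g \<kappa> x v u) \<and>
           (\<forall>u. u \<noteq> 0 \<longrightarrow> 0 < g \<kappa> x u u)) \<and>
        (\<forall>u v. smooth_on (\<lambda>x. g \<kappa> x u v) (chart_image \<kappa>))) \<and>
     (\<forall>\<kappa>\<in>A. \<forall>\<kappa>'\<in>A. \<forall>x\<in>local_dom \<kappa> \<kappa>' id. \<forall>u v.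
        g \<kappa> x u v =
        g \<kappa>' (transition \<kappa> \<kappa>' x) (ddir (transition \<kappa> \<kappa>') x u) (ddir (transition \<kappa> \<kappa>') x v))"

definition riemannian_manifold ::
  "'a topology \<Rightarrow> ('a, 'n::finite) chart set \<Rightarrow>
   (('a, 'n) chart \<Rightarrow> real^'n \<Rightarrow> real^'n \<Rightarrow> real^'n \<Rightarrow> real) \<Rightarrow> bool" where
  "riemannian_manifold X A g \<longleftrightarrow>
     smooth_manifold X A \<and> connected_space X \<and> riemannian_metric A g"


section \<open>Levi-Civita connection and curvature in a chart\<close>

text \<open>Here \<open>G\<close> is a metric on an open set of coordinates.  For constant (coordinate) vector
  fields, \<open>christoffel G x u v\<close> is the Levi-Civita derivative \<open>\<nabla>\<^sub>u v\<close> at \<open>x\<close>, given by the Koszul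
  formula, and \<open>riem_curv G x u v w\<close> is \<open>R(u,v)w = \<nabla>\<^sub>u \<nabla>\<^sub>v w - \<nabla>\<^sub>v \<nabla>\<^sub>u w\<close>.\<close>

definition christoffel ::
  "(real^'n \<Rightarrow> real^'n \<Rightarrow> real^'n \<Rightarrow> real) \<Rightarrow> real^'n \<Rightarrow> real^'n \<Rightarrow> real^'n \<Rightarrow> real^'n::finite" where
  "christoffel G x u v =
     (THE w. \<forall>z. G x w z =
        (ddir (\<lambda>y. G y v z) x u + ddir (\<lambda>y. G y u z) x v - ddir (\<lambda>y. G y u v) x z) / 2)"

definition riem_curv ::
  "(real^'n \<Rightarrow> real^'n \<Rightarrow> real^'n \<Rightarrow> real) \<Rightarrow> real^'n \<Rightarrow> real^'n \<Rightarrow> real^'n \<Rightarrow> real^'n \<Rightarrow> real^'n::finite" where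
  "riem_curv G x u v w =
     ddir (\<lambda>y. christoffel G y v w) x u - ddir (\<lambda>y. christoffel G y u w) x v
     + christoffel G x u (christoffel G x v w) - christoffel G x v (christoffel G x u w)"

text \<open>A 2-vector is given by its components \<open>B\<^sup>i\<^sup>j\<close>, a skew-symmetric matrix.  The inner product
  of 2-vectors is the one with
  \<open>\<langle>u \<and> v, z \<and> w\<rangle> = \<langle>u, z\<rangle> \<langle>v, w\<rangle> - \<langle>u, w\<rangle> \<langle>v, z\<rangle>\<close>.\<close>

definition bivectors :: "(real^'n^'n::finite) set" where
  "bivectors = {B. transpose B = - B}"

definition wedge :: "real^'n \<Rightarrow> real^'n \<Rightarrow> real^'n^'n::finite" where
  "wedge u v = (\<chi> i j. u $ i * v $ j - v $ i * u $ j)"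

definition bivector_inner ::
  "(real^'n \<Rightarrow> real^'n \<Rightarrow> real) \<Rightarrow> real^'n^'n \<Rightarrow> real^'n^'n::finite \<Rightarrow> real" where
  "bivector_inner h B C =
     (\<Sum>i\<in>UNIV. \<Sum>j\<in>UNIV. \<Sum>k\<in>UNIV. \<Sum>l\<in>UNIV.
        B $ i $ j * C $ k $ l * h (axis i 1) (axis k 1) * h (axis j 1) (axis l 1)) / 2"

text \<open>The curvature operator is determined on 2-vectors by
  \<open>\<langle>\<R>(u \<and> v), z \<and> w\<rangle> = \<langle>R(u,v)w, z\<rangle>\<close>; with \<open>R(u,v)w = c (\<langle>v, w\<rangle> u - \<langle>u, w\<rangle> v)\<close>, the case of
  constant sectional curvature \<open>c\<close>, it is \<open>c\<close> times the identity.  Its values on matrices that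
  are not skew-symmetric are irrelevant.\<close>

definition curvature_operator ::
  "(real^'n \<Rightarrow> real^'n \<Rightarrow> real^'n \<Rightarrow> real) \<Rightarrow> real^'n \<Rightarrow> real^'n^'n \<Rightarrow> real^'n^'n::finite" where
  "curvature_operator G x =
     (SOME L. linear L \<and> L ` bivectors \<subseteq> bivectors \<and>
        (\<forall>u v z w. bivector_inner (G x) (L (wedge u v)) (wedge z w) = G x (riem_curv G x u v w) z))"

definition curvature_operator_bounded_below ::
  "('a, 'n::finite) chart set \<Rightarrow>
   (('a, 'n) chart \<Rightarrow> real^'n \<Rightarrow> real^'n \<Rightarrow> real^'n \<Rightarrow> real) \<Rightarrow> real \<Rightarrow> bool" where
  "curvature_operator_bounded_below A g c \<longleftrightarrow>
     (\<forall>\<kappa>\<in>A. \<forall>x\<in>chart_image \<kappa>. \<forall>ev.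
        (\<exists>B\<in>bivectors. B \<noteq> 0 \<and> curvature_operator (g \<kappa>) x B = ev *\<^sub>R B) \<longrightarrow> c \<le> ev)"


section \<open>Kaehler manifolds\<close>

text \<open>A Riemannian manifold with a smooth orthogonal almost complex structure \<open>J\<close> that is parallel
  for the Levi-Civita connection; the last clause is \<open>(\<nabla>\<^sub>u J) v = \<nabla>\<^sub>u (J v) - J (\<nabla>\<^sub>u v) = 0\<close>.\<close>

definition kaehler_manifold ::
  "'a topology \<Rightarrow> ('a, 'n::finite) chart set \<Rightarrow>
   (('a, 'n) chart \<Rightarrow> real^'n \<Rightarrow> real^'n \<Rightarrow> real^'n \<Rightarrow> real) \<Rightarrow>
   (('a, 'n) chart \<Rightarrow> real^'n \<Rightarrow> real^'n \<Rightarrow> real^'n) \<Rightarrow> bool" where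
  "kaehler_manifold X A g J \<longleftrightarrow>
     riemannian_manifold X A g \<and>
     (\<forall>\<kappa>\<in>A. \<forall>u. smooth_on (\<lambda>x. J \<kappa> x u) (chart_image \<kappa>)) \<and>
     (\<forall>\<kappa>\<in>A. \<forall>\<kappa>'\<in>A. \<forall>x\<in>local_dom \<kappa> \<kappa>' id. \<forall>u.
        ddir (transition \<kappa> \<kappa>') x (J \<kappa> x u) =
        J \<kappa>' (transition \<kappa> \<kappa>' x) (ddir (transition \<kappa> \<kappa>') x u)) \<and>
     (\<forall>\<kappa>\<in>A. \<forall>x\<in>chart_image \<kappa>.
        linear (J \<kappa> x) \<and>
        (\<forall>u. J \<kappa> x (J \<kappa> x u) = - u) \<and>
        (\<forall>u v. g \<kappa> x (J \<kappa> x u) (J \<kappa> x v) = g \<kappa> x u v) \<and>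
        (\<forall>u v. ddir (\<lambda>y. J \<kappa> y v) x u + christoffel (g \<kappa>) x u (J \<kappa> x v)
               - J \<kappa> x (christoffel (g \<kappa>) x u v) = 0))"


section \<open>Isometric immersions\<close>

definition isometric_immersion ::
  "'a topology \<Rightarrow> ('a, 'n::finite) chart set \<Rightarrow>
   (('a, 'n) chart \<Rightarrow> real^'n \<Rightarrow> real^'n \<Rightarrow> real^'n \<Rightarrow> real) \<Rightarrow>
   'b topology \<Rightarrow> ('b, 'k::finite) chart set \<Rightarrow>
   (('b, 'k) chart \<Rightarrow> real^'k \<Rightarrow> real^'k \<Rightarrow> real^'k \<Rightarrow> real) \<Rightarrow> ('a \<Rightarrow> 'b) \<Rightarrow> bool" where
  "isometric_immersion X A g Y B h f \<longleftrightarrow>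
     smooth_map X A Y B f \<and>
     (\<forall>\<kappa>\<in>A. \<forall>\<mu>\<in>B. \<forall>x\<in>local_dom \<kappa> \<mu> f.
        inj (ddir (local_rep \<kappa> \<mu> f) x) \<and>
        (\<forall>u v. g \<kappa> x u v =
           h \<mu> (local_rep \<kappa> \<mu> f x) (ddir (local_rep \<kappa> \<mu> f) x u) (ddir (local_rep \<kappa> \<mu> f) x v)))"

text \<open>In the following definitions \<open>G\<close> and \<open>K\<close> are the metrics of the submanifold and of the
  ambient manifold in a chart of each, and \<open>F\<close> is the immersion in these charts.\<close>

text \<open>The component of \<open>w\<close> that is \<open>k\<close>-orthogonal to the range of the linear map \<open>L\<close>:\<close>

definition normal_component ::
  "('b \<Rightarrow> 'b \<Rightarrow> real) \<Rightarrow> ('a \<Rightarrow> 'b) \<Rightarrow> 'b \<Rightarrow> 'b::real_vector" where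
  "normal_component k L w = (THE \<xi>. (\<forall>z. k \<xi> (L z) = 0) \<and> w - \<xi> \<in> range L)"

text \<open>The normal component of the ambient covariant derivative, in the direction \<open>u\<close>, of the
  vector field \<open>y \<mapsto> dF\<^sub>y(v)\<close> along \<open>F\<close>:\<close>

definition second_ff ::
  "(real^'k \<Rightarrow> real^'k \<Rightarrow> real^'k \<Rightarrow> real) \<Rightarrow> (real^'n \<Rightarrow> real^'k) \<Rightarrow>
   real^'n \<Rightarrow> real^'n::finite \<Rightarrow> real^'n \<Rightarrow> real^'k::finite" where
  "second_ff K F x u v =
     normal_component (K (F x)) (ddir F x)
       (ddir (\<lambda>y. ddir F y v) x u + christoffel K (F x) (ddir F x u) (ddir F x v))"

definition orthonormal_frame ::
  "(real^'n \<Rightarrow> real^'n \<Rightarrow> real) \<Rightarrow> ('n \<Rightarrow> real^'n::finite) \<Rightarrow> bool" where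
  "orthonormal_frame k e \<longleftrightarrow> (\<forall>i j. k (e i) (e j) = (if i = j then 1 else 0))"

text \<open>The two quantities below do not depend on the choice of the orthonormal frame.\<close>

definition sff_sq_length ::
  "(real^'n \<Rightarrow> real^'n \<Rightarrow> real^'n \<Rightarrow> real) \<Rightarrow> (real^'k \<Rightarrow> real^'k \<Rightarrow> real^'k \<Rightarrow> real) \<Rightarrow>
   (real^'n \<Rightarrow> real^'k::finite) \<Rightarrow> real^'n::finite \<Rightarrow> real" where
  "sff_sq_length G K F x =
     (let e = (SOME e. orthonormal_frame (G x) e)
      in \<Sum>i\<in>UNIV. \<Sum>j\<in>UNIV.
           K (F x) (second_ff K F x (e i) (e j)) (second_ff K F x (e i) (e j)))"

definition mean_curvature_vector ::
  "(real^'n \<Rightarrow> real^'n \<Rightarrow> real^'n \<Rightarrow> real) \<Rightarrow> (real^'k \<Rightarrow> real^'k \<Rightarrow> real^'k \<Rightarrow> real) \<Rightarrow>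
   (real^'n \<Rightarrow> real^'k::finite) \<Rightarrow> real^'n::finite \<Rightarrow> real^'k" where
  "mean_curvature_vector G K F x =
     (let e = (SOME e. orthonormal_frame (G x) e)
      in (1 / real CARD('n)) *\<^sub>R (\<Sum>i\<in>UNIV. second_ff K F x (e i) (e i)))"

text \<open>The functions \<open>S\<close> and \<open>H\<close> on the submanifold, independent of the choice of charts.\<close>

definition S_fun ::
  "('a, 'n::finite) chart set \<Rightarrow> (('a, 'n) chart \<Rightarrow> real^'n \<Rightarrow> real^'n \<Rightarrow> real^'n \<Rightarrow> real) \<Rightarrow>
   ('b, 'k::finite) chart set \<Rightarrow> (('b, 'k) chart \<Rightarrow> real^'k \<Rightarrow> real^'k \<Rightarrow> real^'k \<Rightarrow> real) \<Rightarrow>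
   ('a \<Rightarrow> 'b) \<Rightarrow> 'a \<Rightarrow> real" where
  "S_fun A g B h f p =
     (let \<kappa> = chart_at A p; \<mu> = chart_at B (f p)
      in sff_sq_length (g \<kappa>) (h \<mu>) (local_rep \<kappa> \<mu> f) (snd \<kappa> p))"

definition H_fun ::
  "('a, 'n::finite) chart set \<Rightarrow> (('a, 'n) chart \<Rightarrow> real^'n \<Rightarrow> real^'n \<Rightarrow> real^'n \<Rightarrow> real) \<Rightarrow>
   ('b, 'k::finite) chart set \<Rightarrow> (('b, 'k) chart \<Rightarrow> real^'k \<Rightarrow> real^'k \<Rightarrow> real^'k \<Rightarrow> real) \<Rightarrow>
   ('a \<Rightarrow> 'b) \<Rightarrow> 'a \<Rightarrow> real" where
  "H_fun A g B h f p =
     (let \<kappa> = chart_at A p; \<mu> = chart_at B (f p);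
          \<eta> = mean_curvature_vector (g \<kappa>) (h \<mu>) (local_rep \<kappa> \<mu> f) (snd \<kappa> p)
      in sqrt (h \<mu> (snd \<mu> (f p)) \<eta> \<eta>))"


section \<open>The lower bound for the squared length\<close>

definition pinch :: "nat \<Rightarrow> nat \<Rightarrow> real \<Rightarrow> real \<Rightarrow> real" where
  "pinch n p t c =
     real n * c + (real n ^ 3 * t\<^sup>2) / (2 * real p * (real n - real p))
     - (real n * \<bar>real n - 2 * real p\<bar> * t) / (2 * real p * (real n - real p))
       * sqrt ((real n)\<^sup>2 * t\<^sup>2 + 4 * real p * (real n - real p) * c)"

end

theory Submission
  imports Defs
begin

text \<open>The argument is pointwise.  Parallelism of \<open>J\<close> makes the curvature tensor \<open>R\<close> commute with
  \<open>J\<close>, so the curvature operator of \<open>M\<close> annihilates the bivectors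
  \<open>e\<^sub>i \<and> e\<^sub>j - J e\<^sub>i \<and> J e\<^sub>j\<close>.  By the Gauss equation, evaluating the ambient curvature operator on
  each of them and summing over an orthonormal frame of size \<open>n\<close> gives
  \<open>c (2 n\<^sup>2 - 4 n) \<le> 2 S - 2 n\<^sup>2 H\<^sup>2 - 2 \<Sum> \<langle>\<alpha>(e\<^sub>i, J e\<^sub>j), \<alpha>(e\<^sub>j, J e\<^sub>i)\<rangle> \<le> 4 S - 2 n\<^sup>2 H\<^sup>2\<close>,
  that is \<open>S \<ge> 2 m\<^sup>2 H\<^sup>2 + 2 m (m - 1) c\<close> for \<open>n = 2 m\<close>; since \<open>H\<^sup>2 + c \<ge> 0\<close>, this exceeds the
  claimed bound by at least \<open>2 m (m - 2) (H\<^sup>2 + c)\<close>.\<close>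

text \<open>The bound is on the curvature operator and not on sectional curvatures because the
  2-vector that enters, the image of u \<and> v - Ju \<and> Jv under the differential of the
  immersion, is in general not decomposable. As R(u,v,Jv,Ju) = R(u,v,v,u), the intrinsic curvature
  drops out when the Gauss equation is inserted, and the ambient curvature is expressed by the
  second fundamental form alone. The constant is a sum of squared lengths: the cross term of u
  \<and> v with Ju \<and> Jv is <u,Jv>^2, so the length is 2 (1 - \<delta>) - 2 <e_i, J e_j>^2, and
  the sum is 2 (n^2 - n) - 2 n. The frame J e is again orthonormal, hence the four square sums are
  all S and the two products of traces are both n^2 H^2, while the trace of \<alpha>(., J .) is its
  own negative. The last inequality of the chain is |\<alpha>(u,Jv) + \<alpha>(v,Ju)|^2 \<ge> 0.
  Eigenvalues enter only through the minimum of a Rayleigh quotient. For this the operator must be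
  self-adjoint, that is, the curvature tensor needs its pair symmetry.\<close>

section \<open>Calculus of directional derivatives\<close>

lemma ddir_eqI: "(f has_derivative f') (at x) \<Longrightarrow> ddir f x v = f' v"
  by (metis frechet_derivative_at)

lemma has_derivative_ddir: "f differentiable (at x) \<Longrightarrow> (f has_derivative ddir f x) (at x)"
  by (simp add: frechet_derivative_works)

text \<open>Differentiability is not assumed: both sides are the same choice from the same set of
  derivatives.\<close>

lemma ddir_cong_open:
  assumes "open S" "x \<in> S" "\<And>y. y \<in> S \<Longrightarrow> f y = g y"
  shows "ddir f x = ddir g x"
proof -
  have "(f has_derivative D) (at x) \<longleftrightarrow> (g has_derivative D) (at x)" for D
    using has_derivative_transform_within_open[OF _ assms(1,2)] assms(3) by metis
  then show ?thesis by (simp add: frechet_derivative_def)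
qed

lemma differentiable_cong_open:
  assumes "g differentiable (at x)" "open S" "x \<in> S" "\<And>y. y \<in> S \<Longrightarrow> f y = g y"
  shows "f differentiable (at x)"
  using assms has_derivative_transform_within_open unfolding differentiable_def by metis

lemma ddir_compose:
  assumes "F differentiable (at x)" "f differentiable (at (F x))"
  shows "ddir (\<lambda>y. f (F y)) x u = ddir f (F x) (ddir F x u)"
  using frechet_derivative_compose[OF assms] by (simp add: o_def fun_eq_iff)

lemma differentiable_compose':
  assumes "F differentiable (at x)" "f differentiable (at (F x))"
  shows "(\<lambda>y. f (F y)) differentiable (at x)"
  using differentiable_chain_at[OF assms] by (simp add: o_def)

lemma ddir_add:
  assumes "f differentiable (at x)" "g differentiable (at x)"
  shows "ddir (\<lambda>y. f y + g y) x u = ddir f x u + ddir g x u"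
  by (rule ddir_eqI) (intro derivative_intros has_derivative_ddir assms)

lemma linear_ddir: "f differentiable (at x) \<Longrightarrow> linear (ddir f x)"
  by (rule linear_frechet_derivative)

section \<open>Smooth functions\<close>

lemma smooth_onD:
  assumes "smooth_on f S"
  shows smooth_on_differentiable: "x \<in> S \<Longrightarrow> f differentiable (at x)"
    and smooth_on_ddir: "smooth_on (\<lambda>x. ddir f x v) S"
    and smooth_on_continuous: "continuous_on S f"
proof -
  have *: "Ck_on k f S" for k using assms by (auto simp: smooth_on_def)
  show "x \<in> S \<Longrightarrow> f differentiable (at x)" using *[of 1] by simp
  show "smooth_on (\<lambda>x. ddir f x v) S" unfolding smooth_on_def using *[of "Suc _"] by auto
  show "continuous_on S f" using *[of 0] by simp
qed

lemma smooth_on_subset: "smooth_on f S \<Longrightarrow> S' \<subseteq> S \<Longrightarrow> smooth_on f S'"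
proof -
  have "Ck_on k f S \<Longrightarrow> S' \<subseteq> S \<Longrightarrow> Ck_on k f S'" for k
    by (induction k arbitrary: f) (auto intro: continuous_on_subset)
  then show "smooth_on f S \<Longrightarrow> S' \<subseteq> S \<Longrightarrow> smooth_on f S'" by (auto simp: smooth_on_def)
qed

lemma Ck_on_const: "Ck_on k (\<lambda>x. c) S"
  by (induction k arbitrary: c) auto

lemma smooth_on_const [simp]: "smooth_on (\<lambda>x. c) S"
  by (simp add: smooth_on_def Ck_on_const)

lemma smooth_on_ident [simp]: "smooth_on (\<lambda>x. x) S"
proof -
  have "Ck_on k (\<lambda>x. x) S" for k
    by (cases k) (simp_all add: Ck_on_const)
  then show ?thesis by (simp add: smooth_on_def)
qed

lemma Ck_on_cong_open:
  assumes "open S" "\<And>y. y \<in> S \<Longrightarrow> f y = g y" "Ck_on k f S"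
  shows "Ck_on k g S"
  using assms(2,3)
proof (induction k arbitrary: f g)
  case 0
  then show ?case using continuous_on_cong by (metis Ck_on.simps(1))
next
  case (Suc k)
  have d: "f differentiable (at x)" if "x \<in> S" for x using Suc.prems(2) that by simp
  have "ddir f x = ddir g x" if "x \<in> S" for x
    by (rule ddir_cong_open[OF assms(1) that Suc.prems(1)])
  moreover have "g differentiable (at x)" if "x \<in> S" for x
    by (rule differentiable_cong_open[OF d[OF that] assms(1) that]) (simp add: Suc.prems(1))
  ultimately show ?case
    using Suc.prems(2) Suc.IH[of "\<lambda>x. ddir f x v" "\<lambda>x. ddir g x v" for v] by auto
qed

text \<open>Serves to take scalar components in \<open>ddir_commute\<close>. Composition with
  \<open>T\<close> commutes with \<open>ddir\<close>, so the induction only replaces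
  \<open>f\<close> by its directional derivatives.\<close>

lemma smooth_on_bounded_linear:
  assumes "open S" "bounded_linear T" "smooth_on f S"
  shows "smooth_on (\<lambda>x. T (f x)) S"
proof -
  have "Ck_on k (\<lambda>x. T (f x)) S" if "smooth_on f S" for k
    using that
  proof (induction k arbitrary: f)
    case 0
    then show ?case
      using smooth_on_continuous bounded_linear.continuous_on[OF assms(2)] by auto
  next
    case (Suc k)
    have D: "((\<lambda>x. T (f x)) has_derivative (\<lambda>v. T (ddir f x v))) (at x)" if "x \<in> S" for x
      by (rule bounded_linear.has_derivative[OF assms(2)])
        (rule has_derivative_ddir[OF smooth_on_differentiable[OF Suc.prems that]])
    have "Ck_on k (\<lambda>x. ddir (\<lambda>x. T (f x)) x v) S" for v
      by (rule Ck_on_cong_open[OF assms(1) _ Suc.IH[OF smooth_on_ddir[OF Suc.prems]]])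
        (simp add: ddir_eqI[OF D])
    then show ?case using D by (auto simp: differentiable_def)
  qed
  then show ?thesis using assms by (simp add: smooth_on_def)
qed

section \<open>Symmetry of second derivatives\<close>

lemma DERIV_along_line:
  fixes f :: "'a::real_normed_vector \<Rightarrow> real"
  assumes "f differentiable (at (p + s *\<^sub>R w))"
  shows "DERIV (\<lambda>s. f (p + s *\<^sub>R w)) s :> ddir f (p + s *\<^sub>R w) w"
proof -
  have line: "((\<lambda>s. p + s *\<^sub>R w) has_derivative (\<lambda>r. r *\<^sub>R w)) (at s)"
    by (auto intro!: derivative_eq_intros)
  have "((\<lambda>s. f (p + s *\<^sub>R w)) has_derivative (\<lambda>r. ddir f (p + s *\<^sub>R w) (r *\<^sub>R w))) (at s)"
    using has_derivative_compose[OF line has_derivative_ddir[OF assms]] .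
  moreover have "(\<lambda>r. ddir f (p + s *\<^sub>R w) (r *\<^sub>R w)) = (*) (ddir f (p + s *\<^sub>R w) w)"
    by (simp add: fun_eq_iff linear_cmul[OF linear_ddir[OF assms]])
  ultimately show ?thesis by (simp only: has_field_derivative_def)
qed

text \<open>The mean value theorem is used twice, along \<open>u\<close> and then along
  \<open>v\<close>. The left side is symmetric in \<open>u\<close> and \<open>v\<close> while the
  right side is not, which is what \<open>ddir_commute_real\<close> exploits.\<close>

lemma second_difference:
  fixes f :: "'a::real_normed_vector \<Rightarrow> real"
  assumes sm: "smooth_on f S" and h: "0 < h"
    and S: "\<And>s t. 0 \<le> s \<Longrightarrow> s \<le> h \<Longrightarrow> 0 \<le> t \<Longrightarrow> t \<le> h \<Longrightarrow> x + s *\<^sub>R u + t *\<^sub>R v \<in> S"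
  obtains s t where "0 < s" "s < h" "0 < t" "t < h"
    "f (x + h *\<^sub>R u + h *\<^sub>R v) - f (x + h *\<^sub>R u) - f (x + h *\<^sub>R v) + f x
      = h * h * ddir (\<lambda>y. ddir f y u) (x + s *\<^sub>R u + t *\<^sub>R v) v"
proof -
  have S': "x + t *\<^sub>R v + s *\<^sub>R u \<in> S" if "0 \<le> s" "s \<le> h" "0 \<le> t" "t \<le> h" for s t
    using S[OF that] by (simp add: ac_simps)
  \<comment> \<open>The difference across the parallelogram in direction \<open>v\<close>, as a
    function of the position along \<open>u\<close>. The summand \<open>0 *\<^sub>R v\<close> gives
    both terms the shape required by \<open>S'\<close>.\<close>
  define \<phi> where "\<phi> s = f ((x + h *\<^sub>R v) + s *\<^sub>R u) - f ((x + 0 *\<^sub>R v) + s *\<^sub>R u)" for s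
  define \<phi>' where "\<phi>' s = ddir f ((x + h *\<^sub>R v) + s *\<^sub>R u) u - ddir f ((x + 0 *\<^sub>R v) + s *\<^sub>R u) u" for s
  have dphi: "DERIV \<phi> s :> \<phi>' s" if "0 \<le> s" "s \<le> h" for s
    unfolding \<phi>_def \<phi>'_def
    by (rule DERIV_diff; rule DERIV_along_line; rule smooth_on_differentiable[OF sm]; rule S')
      (use that h in auto)
  obtain s where s: "0 < s" "s < h" "\<phi> h - \<phi> 0 = (h - 0) * \<phi>' s"
    using MVT2[OF h dphi] by blast
  define \<psi> where "\<psi> t = ddir f ((x + s *\<^sub>R u) + t *\<^sub>R v) u" for t
  define \<psi>' where "\<psi>' t = ddir (\<lambda>y. ddir f y u) ((x + s *\<^sub>R u) + t *\<^sub>R v) v" for t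
  have dpsi: "DERIV \<psi> t :> \<psi>' t" if "0 \<le> t" "t \<le> h" for t
    unfolding \<psi>_def \<psi>'_def
    by (rule DERIV_along_line; rule smooth_on_differentiable[OF smooth_on_ddir[OF sm]]; rule S)
      (use that s in auto)
  obtain t where t: "0 < t" "t < h" "\<psi> h - \<psi> 0 = (h - 0) * \<psi>' t"
    using MVT2[OF h dpsi] by blast
  have "\<phi>' s = \<psi> h - \<psi> 0" unfolding \<phi>'_def \<psi>_def by (simp add: ac_simps)
  then have "\<phi> h - \<phi> 0 = h * h * \<psi>' t" using s(3) t(3) by simp
  then show ?thesis
    by (intro that[OF s(1,2) t(1,2)]) (simp add: \<phi>_def \<psi>'_def ac_simps)
qed

text \<open>If the two mixed derivatives differed at \<open>x\<close>, continuity would keep their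
  values apart on a small parallelogram; but the second difference is \<open>h * h\<close> times a
  value of each of them there.\<close>

lemma ddir_commute_real:
  fixes f :: "'a::real_normed_vector \<Rightarrow> real"
  assumes S: "open S" "x \<in> S" and sm: "smooth_on f S"
  shows "ddir (\<lambda>y. ddir f y u) x v = ddir (\<lambda>y. ddir f y v) x u"
proof (rule ccontr)
  define P where "P y = ddir (\<lambda>y. ddir f y u) y v" for y
  define Q where "Q y = ddir (\<lambda>y. ddir f y v) y u" for y
  assume "\<not> ?thesis"
  then have ne: "0 < \<bar>P x - Q x\<bar>" by (simp add: P_def Q_def)
  have cP: "continuous_on S P" and cQ: "continuous_on S Q"
    unfolding P_def Q_def by (intro smooth_on_continuous smooth_on_ddir sm)+
  obtain r1 where r1: "r1 > 0" "\<And>y. y \<in> S \<Longrightarrow> dist y x < r1 \<Longrightarrow> dist (P y) (P x) < \<bar>P x - Q x\<bar> / 2"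
    using cP S(2) ne unfolding continuous_on_iff by (metis half_gt_zero)
  obtain r2 where r2: "r2 > 0" "\<And>y. y \<in> S \<Longrightarrow> dist y x < r2 \<Longrightarrow> dist (Q y) (Q x) < \<bar>P x - Q x\<bar> / 2"
    using cQ S(2) ne unfolding continuous_on_iff by (metis half_gt_zero)
  obtain r3 where r3: "r3 > 0" "ball x r3 \<subseteq> S" using S open_contains_ball by blast
  define r where "r = min r1 (min r2 r3)"
  \<comment> \<open>The summand 1 keeps \<open>N\<close> positive for \<open>u = v = 0\<close>; with
    \<open>h = r / (2 * N)\<close> the parallelogram stays within distance \<open>r / 2\<close> of
    \<open>x\<close>.\<close>
  define N where "N = norm u + norm v + 1"
  have N: "N > 0" unfolding N_def by (intro add_nonneg_pos) auto
  define h where "h = r / (2 * N)"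
  have r: "r > 0" using r1 r2 r3 by (simp add: r_def)
  have h: "h > 0" using r N by (simp add: h_def)
  have near: "dist (x + s *\<^sub>R u + t *\<^sub>R v) x < r" if "0 \<le> s" "s \<le> h" "0 \<le> t" "t \<le> h" for s t
  proof -
    have "dist (x + s *\<^sub>R u + t *\<^sub>R v) x \<le> s * norm u + t * norm v"
      using norm_triangle_ineq[of "s *\<^sub>R u" "t *\<^sub>R v"] that
      by (simp add: dist_norm add.assoc)
    also have "\<dots> \<le> h * norm u + h * norm v"
      using that by (intro add_mono mult_right_mono) auto
    also have "\<dots> \<le> h * (norm u + norm v + 1)" using h by (simp add: algebra_simps)
    also have "\<dots> = r / 2"
      unfolding h_def N_def[symmetric] using N by simp
    finally show ?thesis using r by simp
  qed
  have inS: "x + s *\<^sub>R u + t *\<^sub>R v \<in> S" if "0 \<le> s" "s \<le> h" "0 \<le> t" "t \<le> h" for s t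
    using near[OF that] r3(2) by (auto simp: r_def dist_commute)
  have inS': "x + s *\<^sub>R v + t *\<^sub>R u \<in> S" if "0 \<le> s" "s \<le> h" "0 \<le> t" "t \<le> h" for s t
    using inS[of t s] that by (simp add: ac_simps)
  obtain s t where st: "0 < s" "s < h" "0 < t" "t < h"
    "f (x + h *\<^sub>R u + h *\<^sub>R v) - f (x + h *\<^sub>R u) - f (x + h *\<^sub>R v) + f x = h * h * P (x + s *\<^sub>R u + t *\<^sub>R v)"
    unfolding P_def by (rule second_difference[OF sm h inS]) assumption+
  obtain s' t' where st': "0 < s'" "s' < h" "0 < t'" "t' < h"
    "f (x + h *\<^sub>R v + h *\<^sub>R u) - f (x + h *\<^sub>R v) - f (x + h *\<^sub>R u) + f x = h * h * Q (x + s' *\<^sub>R v + t' *\<^sub>R u)"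
    unfolding Q_def by (rule second_difference[OF sm h inS']) assumption+
  have "h * h * P (x + s *\<^sub>R u + t *\<^sub>R v) = h * h * Q (x + s' *\<^sub>R v + t' *\<^sub>R u)"
    using st(5) st'(5) unfolding add.assoc add.commute[of "h *\<^sub>R v" "h *\<^sub>R u"] by linarith
  then have eq: "P (x + s *\<^sub>R u + t *\<^sub>R v) = Q (x + t' *\<^sub>R u + s' *\<^sub>R v)" using h by (simp add: ac_simps)
  have "dist (P (x + s *\<^sub>R u + t *\<^sub>R v)) (P x) < \<bar>P x - Q x\<bar> / 2"
    using r1(2)[OF inS] near st by (simp add: r_def)
  moreover have "dist (Q (x + t' *\<^sub>R u + s' *\<^sub>R v)) (Q x) < \<bar>P x - Q x\<bar> / 2"
    using r2(2)[OF inS] near st' by (simp add: r_def)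
  ultimately show False unfolding eq dist_real_def by argo
qed

lemma ddir_commute:
  fixes f :: "'a::real_normed_vector \<Rightarrow> 'b::euclidean_space"
  assumes S: "open S" "x \<in> S" and sm: "smooth_on f S"
  shows "ddir (\<lambda>y. ddir f y u) x v = ddir (\<lambda>y. ddir f y v) x u"
proof (rule euclidean_eqI)
  fix b :: 'b
  have 1: "ddir (\<lambda>y. g y \<bullet> b) y w = ddir g y w \<bullet> b" if "g differentiable (at y)" for g :: "'a \<Rightarrow> 'b" and y w
    by (rule ddir_eqI) (intro derivative_intros has_derivative_ddir that)
  have 2: "ddir (\<lambda>y. ddir f y u) x v \<bullet> b = ddir (\<lambda>y. ddir (\<lambda>y. f y \<bullet> b) y u) x v" for u v
  proof -
    have "ddir (\<lambda>y. ddir f y u) x v \<bullet> b = ddir (\<lambda>y. ddir f y u \<bullet> b) x v"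
      using 1 smooth_on_differentiable[OF smooth_on_ddir[OF sm] S(2)] by simp
    also have "\<dots> = ddir (\<lambda>y. ddir (\<lambda>y. f y \<bullet> b) y u) x v"
      using ddir_cong_open[OF S, of "\<lambda>y. ddir f y u \<bullet> b" "\<lambda>y. ddir (\<lambda>y. f y \<bullet> b) y u"]
        1 smooth_on_differentiable[OF sm] by simp
    finally show ?thesis .
  qed
  have "smooth_on (\<lambda>y. f y \<bullet> b) S"
    by (rule smooth_on_bounded_linear[OF S(1) bounded_linear_inner_left sm])
  then show "ddir (\<lambda>y. ddir f y u) x v \<bullet> b = ddir (\<lambda>y. ddir f y v) x u \<bullet> b"
    unfolding 2 by (rule ddir_commute_real[OF S])
qed

section \<open>Families of linear and bilinear maps\<close>

lemma linear_ddir_family: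
  assumes "open S" "x \<in> S" "\<And>y. y \<in> S \<Longrightarrow> linear (\<Psi> y)" "\<And>b. (\<lambda>y. \<Psi> y b) differentiable (at x)"
  shows "linear (\<lambda>b. ddir (\<lambda>y. \<Psi> y b) x u)"
proof (rule linearI)
  fix a b
  show "ddir (\<lambda>y. \<Psi> y (a + b)) x u = ddir (\<lambda>y. \<Psi> y a) x u + ddir (\<lambda>y. \<Psi> y b) x u"
    using ddir_cong_open[OF assms(1,2), of "\<lambda>y. \<Psi> y (a + b)" "\<lambda>y. \<Psi> y a + \<Psi> y b"]
    by (simp add: ddir_add assms(3,4) linear_add)
next
  fix r b
  have "ddir (\<lambda>y. r *\<^sub>R \<Psi> y b) x u = r *\<^sub>R ddir (\<lambda>y. \<Psi> y b) x u"
    by (rule ddir_eqI) (intro derivative_intros has_derivative_ddir assms)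
  then show "ddir (\<lambda>y. \<Psi> y (r *\<^sub>R b)) x u = r *\<^sub>R ddir (\<lambda>y. \<Psi> y b) x u"
    using ddir_cong_open[OF assms(1,2), of "\<lambda>y. \<Psi> y (r *\<^sub>R b)" "\<lambda>y. r *\<^sub>R \<Psi> y b"]
    by (simp add: assms(3) linear_cmul)
qed

lemma linear_expand:
  fixes b :: "'b::euclidean_space"
  assumes "linear T"
  shows "T b = (\<Sum>i\<in>Basis. (b \<bullet> i) *\<^sub>R T i)"
  by (metis (no_types, lifting) assms euclidean_representation linear_cmul linear_sum sum.cong)

text \<open>Leibniz rule for a moving linear map at a moving vector. Expanding
  \<open>\<beta> y\<close> in \<open>Basis\<close> reduces it to the derivatives of
  \<open>\<Psi> y b\<close> for fixed \<open>b\<close>, so no topology on operators is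
  involved.\<close>

lemma has_derivative_linear_family:
  fixes \<Psi> :: "'a::real_normed_vector \<Rightarrow> 'b::euclidean_space \<Rightarrow> 'c::real_normed_vector"
  assumes S: "open S" "x \<in> S" and lin: "\<And>y. y \<in> S \<Longrightarrow> linear (\<Psi> y)"
    and d: "\<And>b. (\<lambda>y. \<Psi> y b) differentiable (at x)" and \<beta>: "\<beta> differentiable (at x)"
  shows "((\<lambda>y. \<Psi> y (\<beta> y)) has_derivative (\<lambda>u. ddir (\<lambda>y. \<Psi> y (\<beta> x)) x u + \<Psi> x (ddir \<beta> x u))) (at x)"
proof -
  have "((\<lambda>y. \<Sum>i\<in>Basis. (\<beta> y \<bullet> i) *\<^sub>R \<Psi> y i) has_derivative
      (\<lambda>u. \<Sum>i\<in>Basis. (\<beta> x \<bullet> i) *\<^sub>R ddir (\<lambda>y. \<Psi> y i) x u + (ddir \<beta> x u \<bullet> i) *\<^sub>R \<Psi> x i)) (at x)"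
    by (intro derivative_intros has_derivative_ddir d \<beta>)
  then have "((\<lambda>y. \<Psi> y (\<beta> y)) has_derivative
      (\<lambda>u. \<Sum>i\<in>Basis. (\<beta> x \<bullet> i) *\<^sub>R ddir (\<lambda>y. \<Psi> y i) x u + (ddir \<beta> x u \<bullet> i) *\<^sub>R \<Psi> x i)) (at x)"
    by (rule has_derivative_transform_within_open[OF _ S]) (simp add: linear_expand[OF lin, symmetric])
  then show ?thesis
    by (simp add: sum.distrib linear_expand[OF lin[OF S(2)], symmetric]
        linear_expand[OF linear_ddir_family[OF S lin d], symmetric])
qed

lemma has_derivative_bilinear_family:
  fixes \<Phi> :: "'a::real_normed_vector \<Rightarrow> 'b::euclidean_space \<Rightarrow> 'c::euclidean_space \<Rightarrow> 'd::real_normed_vector"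
  assumes S: "open S" "x \<in> S" and bil: "\<And>y. y \<in> S \<Longrightarrow> bilinear (\<Phi> y)"
    and d: "\<And>b c. (\<lambda>y. \<Phi> y b c) differentiable (at x)"
    and \<beta>: "\<beta> differentiable (at x)" and \<gamma>: "\<gamma> differentiable (at x)"
  shows "((\<lambda>y. \<Phi> y (\<beta> y) (\<gamma> y)) has_derivative
    (\<lambda>u. ddir (\<lambda>y. \<Phi> y (\<beta> x) (\<gamma> x)) x u + \<Phi> x (ddir \<beta> x u) (\<gamma> x) + \<Phi> x (\<beta> x) (ddir \<gamma> x u))) (at x)"
proof -
  have D: "((\<lambda>y. \<Phi> y (\<beta> y) c) has_derivative
      (\<lambda>u. ddir (\<lambda>y. \<Phi> y (\<beta> x) c) x u + \<Phi> x (ddir \<beta> x u) c)) (at x)" for c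
    by (rule has_derivative_linear_family[OF S, of "\<lambda>y b. \<Phi> y b c"])
      (use bil d \<beta> in \<open>auto simp: bilinear_def\<close>)
  have lin: "linear (\<Phi> y b)" if "y \<in> S" for y b using bil[OF that] by (simp add: bilinear_def)
  have dD: "(\<lambda>y. \<Phi> y (\<beta> y) c) differentiable (at x)" for c
    by (rule differentiableI[OF D])
  have "((\<lambda>y. \<Phi> y (\<beta> y) (\<gamma> y)) has_derivative
      (\<lambda>u. ddir (\<lambda>y. \<Phi> y (\<beta> y) (\<gamma> x)) x u + \<Phi> x (\<beta> x) (ddir \<gamma> x u))) (at x)"
    by (rule has_derivative_linear_family[where \<Psi> = "\<lambda>y c. \<Phi> y (\<beta> y) c", OF S lin dD \<gamma>])
  moreover have "ddir (\<lambda>y. \<Phi> y (\<beta> y) (\<gamma> x)) x u = ddir (\<lambda>y. \<Phi> y (\<beta> x) (\<gamma> x)) x u + \<Phi> x (ddir \<beta> x u) (\<gamma> x)" for u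
    by (rule ddir_eqI[OF D])
  ultimately show ?thesis by simp
qed

section \<open>Inner products\<close>

text \<open>Stated over any Euclidean type, since it is instantiated both at tangent vectors and,
  with \<open>bivector_inner\<close>, at matrices.\<close>

locale inner_form =
  fixes k :: "'a::euclidean_space \<Rightarrow> 'a \<Rightarrow> real"
  assumes bil: "bilinear k" and sym: "k u v = k v u" and pos: "u \<noteq> 0 \<Longrightarrow> 0 < k u u"
begin

lemma linear_left: "linear (\<lambda>u. k u v)" and linear_right: "linear (k u)"
  using bil by (auto simp: bilinear_def)

lemma simps: "k (a + b) c = k a c + k b c" "k c (a + b) = k c a + k c b"
  "k (a - b) c = k a c - k b c" "k c (a - b) = k c a - k c b"
  "k (- a) c = - k a c" "k c (- a) = - k c a"
  "k (r *\<^sub>R a) c = r * k a c" "k c (r *\<^sub>R a) = r * k c a"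
  "k 0 c = 0" "k c 0 = 0"
  using linear_add[OF linear_left] linear_add[OF linear_right] linear_diff[OF linear_left]
    linear_diff[OF linear_right] linear_neg[OF linear_left] linear_neg[OF linear_right]
    linear_cmul[OF linear_left] linear_cmul[OF linear_right] linear_0[OF linear_left] linear_0[OF linear_right]
  by auto

lemma sum_left: "k (\<Sum>i\<in>I. f i) c = (\<Sum>i\<in>I. k (f i) c)"
  and sum_right: "k c (\<Sum>i\<in>I. f i) = (\<Sum>i\<in>I. k c (f i))"
  using linear_sum[OF linear_left] linear_sum[OF linear_right] by auto

lemma nonneg: "0 \<le> k u u"
  using pos[of u] by (cases "u = 0") (auto simp: simps)

lemma eqI: "(\<And>z. k a z = k b z) \<Longrightarrow> a = b"
  using pos[of "a - b"] by (auto simp: simps)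

text \<open>Riesz representation: \<open>T\<close> lists the values of \<open>k t\<close> on
  \<open>Basis\<close>, is injective by definiteness and surjective by dimension. It gives meaning
  to the \<open>THE\<close> in \<open>christoffel\<close> and to the operator built in
  \<open>ex_bivector_operator\<close>.\<close>

lemma ex1_represent:
  assumes "linear \<phi>"
  shows "\<exists>!t. \<forall>z. k t z = \<phi> z"
proof (rule ex_ex1I)
  define T where "T t = (\<Sum>i\<in>Basis. k t i *\<^sub>R i)" for t
  have Ti: "T t \<bullet> i = k t i" if "i \<in> Basis" for t i
    using that by (simp add: T_def)
  have "linear T"
    by (rule linearI) (simp_all add: T_def simps scaleR_add_left sum.distrib scaleR_sum_right)
  moreover have "inj T"
    unfolding linear_injective_0[OF \<open>linear T\<close>]
  proof (intro allI impI)
    fix t assume "T t = 0"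
    then have "k t i = 0" if "i \<in> Basis" for i using Ti[OF that, of t] by simp
    then have "k t z = k 0 z" for z
      using linear_expand[OF linear_right, of t z] by (simp add: simps)
    then show "t = 0" by (rule eqI)
  qed
  ultimately have "surj T" by (rule linear_injective_imp_surjective) simp
  then obtain t where t: "T t = (\<Sum>i\<in>Basis. \<phi> i *\<^sub>R i)" by (metis surjD)
  have "k t i = \<phi> i" if "i \<in> Basis" for i
    using Ti[OF that, of t] that by (simp add: t)
  then have "k t z = \<phi> z" for z
    using linear_expand[OF linear_right, of t z] linear_expand[OF assms, of z] by simp
  then show "\<exists>t. \<forall>z. k t z = \<phi> z" by blast
next
  fix a b assume "\<forall>z. k a z = \<phi> z" "\<forall>z. k b z = \<phi> z"
  then show "a = b" using eqI[of a b] by simp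
qed

end

section \<open>The Levi-Civita connection of a metric in coordinates\<close>

text \<open>The Koszul formula for constant fields, i.e. the Christoffel symbols of the first kind;
  \<open>christoffel\<close> is obtained by raising the last index.\<close>

definition koszul :: "('a \<Rightarrow> 'a \<Rightarrow> 'a \<Rightarrow> real) \<Rightarrow> 'a \<Rightarrow> 'a \<Rightarrow> 'a \<Rightarrow> 'a::real_normed_vector \<Rightarrow> real" where
  "koszul G x u v z =
    (ddir (\<lambda>y. G y v z) x u + ddir (\<lambda>y. G y u z) x v - ddir (\<lambda>y. G y u v) x z) / 2"

lemma differentiable_det:
  fixes M :: "'a::real_normed_vector \<Rightarrow> real^'n^'n"
  assumes "\<And>i j. (\<lambda>y. M y $ i $ j) differentiable (at x)"
  shows "(\<lambda>y. det (M y)) differentiable (at x)"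
proof -
  have "(\<lambda>y. \<Prod>i\<in>UNIV. M y $ i $ p i) differentiable (at x)" for p
    by (rule differentiableI, rule has_derivative_prod) (rule has_derivative_ddir[OF assms])
  then show ?thesis unfolding det_def by (intro derivative_intros) auto
qed

lemma differentiable_vec:
  fixes f :: "'a::real_normed_vector \<Rightarrow> real^'n"
  assumes "\<And>i. (\<lambda>y. f y $ i) differentiable (at x)"
  shows "f differentiable (at x)"
proof -
  have "(\<lambda>y. f y \<bullet> b) differentiable (at x)" if "b \<in> Basis" for b
    using that assms by (auto simp: Basis_vec_def inner_axis)
  then show ?thesis by (subst differentiable_componentwise_within) auto
qed

text \<open>The domain is a parameter of its own because it is a whole chart image for the ambient
  metric but only a \<open>local_dom\<close> for the metric of the submanifold.\<close>

locale metric_chart =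
  fixes U :: "(real^'n::finite) set" and G :: "real^'n \<Rightarrow> real^'n \<Rightarrow> real^'n \<Rightarrow> real"
  assumes open_dom: "open U"
    and inner_form: "x \<in> U \<Longrightarrow> inner_form (G x)"
    and smooth: "smooth_on (\<lambda>x. G x u v) U"
begin

lemma diff: "x \<in> U \<Longrightarrow> (\<lambda>y. G y u v) differentiable (at x)"
  by (rule smooth_on_differentiable[OF smooth])

lemma bilinear: "x \<in> U \<Longrightarrow> bilinear (G x)"
  using inner_form.bil[OF inner_form] .

lemma ddir_metric_sym: "x \<in> U \<Longrightarrow> ddir (\<lambda>y. G y u v) x = ddir (\<lambda>y. G y v u) x"
  by (rule ddir_cong_open[OF open_dom]) (auto intro: inner_form.sym[OF inner_form])

lemma linear_ddir_metric:
  assumes "x \<in> U"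
  shows "linear (ddir (\<lambda>y. G y v z) x)" "linear (\<lambda>v. ddir (\<lambda>y. G y v z) x u)"
    "linear (\<lambda>z. ddir (\<lambda>y. G y v z) x u)"
proof -
  have *: "linear (\<lambda>v. G y v z)" "linear (G y v)" if "y \<in> U" for y v z
    using bilinear[OF that] by (auto simp: bilinear_def)
  show "linear (ddir (\<lambda>y. G y v z) x)" by (rule linear_ddir[OF diff[OF assms]])
  show "linear (\<lambda>v. ddir (\<lambda>y. G y v z) x u)"
    by (rule linear_ddir_family[OF open_dom assms, where \<Psi> = "\<lambda>y v. G y v z"]) (intro * diff assms; assumption)+
  show "linear (\<lambda>z. ddir (\<lambda>y. G y v z) x u)"
    by (rule linear_ddir_family[OF open_dom assms, where \<Psi> = "\<lambda>y z. G y v z"]) (intro * diff assms; assumption)+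
qed

lemma linear_koszul:
  assumes "x \<in> U"
  shows "linear (\<lambda>u. koszul G x u v z)" "linear (\<lambda>v. koszul G x u v z)" "linear (koszul G x u v)"
  unfolding koszul_def
  by (rule linearI; simp add: linear_add[OF linear_ddir_metric(1)[OF assms]] linear_add[OF linear_ddir_metric(2)[OF assms]]
    linear_add[OF linear_ddir_metric(3)[OF assms]] linear_cmul[OF linear_ddir_metric(1)[OF assms]]
    linear_cmul[OF linear_ddir_metric(2)[OF assms]] linear_cmul[OF linear_ddir_metric(3)[OF assms]] algebra_simps add_divide_distrib diff_divide_distrib)+

lemma koszul_sym: "x \<in> U \<Longrightarrow> koszul G x u v z = koszul G x v u z"
  by (simp add: koszul_def ddir_metric_sym[of x u v])

lemma christoffel:
  assumes "x \<in> U"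
  shows "G x (christoffel G x u v) z = koszul G x u v z"
  using theI'[OF inner_form.ex1_represent[OF inner_form[OF assms] linear_koszul(3)[OF assms, of u v]]]
  unfolding christoffel_def koszul_def by blast

lemma christoffel_sym: "x \<in> U \<Longrightarrow> christoffel G x u v = christoffel G x v u"
  by (rule inner_form.eqI[OF inner_form]) (auto simp: christoffel koszul_sym)

lemma bilinear_christoffel:
  assumes "x \<in> U"
  shows "bilinear (christoffel G x)"
proof -
  note [simp] = inner_form.simps[OF inner_form[OF assms]] christoffel[OF assms]
  note linear = linear_koszul[OF assms]
  show ?thesis
    unfolding bilinear_def
    by (intro allI conjI linearI inner_form.eqI[OF inner_form[OF assms]])
      (simp_all add: linear_add[OF linear(1)] linear_add[OF linear(2)] linear_cmul[OF linear(1)] linear_cmul[OF linear(2)])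
qed

text \<open>In coordinates the Christoffel symbols solve a linear system with the Gram matrix of the
  metric, so Cramer's rule makes them differentiable.\<close>

lemma differentiable_christoffel:
  assumes x: "x \<in> U"
  shows "(\<lambda>y. christoffel G y u v) differentiable (at x)"
proof -
  define M where "M y = (\<chi> i j. G y (axis j 1) (axis i 1))" for y
  define b where "b y = (\<chi> i. koszul G y u v (axis i 1))" for y
  have M: "(M y *v w) $ i = G y w (axis i 1)" if "y \<in> U" for y w i
  proof -
    interpret inner_form "G y" by (rule inner_form[OF that])
    have "G y w (axis i 1) = G y (\<Sum>j\<in>UNIV. w $ j *\<^sub>R axis j 1) (axis i 1)"
      using basis_expansion[of w] by (simp add: scalar_mult_eq_scaleR)
    then show ?thesis by (simp add: M_def matrix_vector_mult_def sum_left simps mult.commute)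
  qed
  \<comment> \<open>A vector in the kernel of the Gram matrix is orthogonal to every basis vector,
    hence zero.\<close>
  have det: "det (M y) \<noteq> 0" if y: "y \<in> U" for y
  proof -
    interpret inner_form "G y" by (rule inner_form[OF y])
    have "w = 0" if "M y *v w = 0" for w
    proof -
      have "G y w (axis i 1) = 0" for i using M[OF y, of w i] that by simp
      then have "G y w z = G y 0 z" for z
        using linear_expand[OF linear_right, of w z] by (auto simp: Basis_vec_def simps intro!: sum.neutral)
      then show ?thesis by (rule eqI)
    qed
    then show ?thesis
      by (metis invertible_det_nz matrix_left_invertible_ker matrix_left_right_inverse invertible_def)
  qed
  have eq: "christoffel G y u v = (\<chi> l. det (\<chi> i j. if j = l then b y $ i else M y $ i $ j) / det (M y))"
    if "y \<in> U" for y
  proof -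
    have "M y *v christoffel G y u v = b y"
      by (simp add: vec_eq_iff M[OF that] b_def christoffel[OF that])
    then show ?thesis using cramer[OF det[OF that]] by blast
  qed
  have dM: "(\<lambda>y. M y $ i $ j) differentiable (at x)" for i j
    by (simp add: M_def diff[OF x])
  have dk: "(\<lambda>y. koszul G y u v z) differentiable (at x)" for z
    unfolding koszul_def
    by (intro derivative_intros smooth_on_differentiable[OF smooth_on_ddir[OF smooth] x]) auto
  have "(\<lambda>y. \<chi> l. det (\<chi> i j. if j = l then b y $ i else M y $ i $ j) / det (M y)) differentiable (at x)"
  proof (rule differentiable_vec)
    fix l
    have "(\<lambda>y. det (\<chi> i j. if j = l then b y $ i else M y $ i $ j)) differentiable (at x)"
    proof (rule differentiable_det)
      fix i j
      show "(\<lambda>y. (\<chi> i j. if j = l then b y $ i else M y $ i $ j) $ i $ j) differentiable (at x)"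
        by (cases "j = l") (simp_all add: b_def dk dM)
    qed
    then show "(\<lambda>y. (\<chi> l. det (\<chi> i j. if j = l then b y $ i else M y $ i $ j) / det (M y)) $ l) differentiable (at x)"
      using differentiable_det[of M, OF dM] det[OF x] by (simp add: differentiable_divide)
  qed
  then show ?thesis
    by (rule differentiable_cong_open[OF _ open_dom x]) (rule eq)
qed

end

section \<open>Covariant derivatives along a map\<close>

text \<open>The connection pulled back along \<open>F\<close>, applied to a field \<open>W\<close>
  along \<open>F\<close>. With \<open>F\<close> the identity it is the Levi-Civita connection, so
  that one computation of the commutator covers intrinsic and ambient curvature.\<close>

definition cov ::
  "(real^'k \<Rightarrow> real^'k \<Rightarrow> real^'k \<Rightarrow> real) \<Rightarrow> ('a \<Rightarrow> real^'k) \<Rightarrow> ('a \<Rightarrow> real^'k) \<Rightarrow>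
   'a::euclidean_space \<Rightarrow> 'a \<Rightarrow> real^'k::finite" where
  "cov K F W x u = ddir W x u + christoffel K (F x) (ddir F x u) (W x)"

lemma cov_cong_open:
  assumes "open S" "x \<in> S" "\<And>y. y \<in> S \<Longrightarrow> W y = W' y"
  shows "cov K F W x u = cov K F W' x u"
  using ddir_cong_open[OF assms] assms(2,3) by (simp add: cov_def)

locale chart_map = metric_chart V K
  for V :: "(real^'k::finite) set" and K +
  fixes U :: "'a::euclidean_space set" and F :: "'a \<Rightarrow> real^'k"
  assumes open_U: "open U" and smooth_F: "smooth_on F U" and F_in: "x \<in> U \<Longrightarrow> F x \<in> V"
begin

lemma F_diff: "x \<in> U \<Longrightarrow> F differentiable (at x)"
  and dF_diff: "x \<in> U \<Longrightarrow> (\<lambda>y. ddir F y v) differentiable (at x)"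
  using smooth_on_differentiable[OF smooth_F] smooth_on_differentiable[OF smooth_on_ddir[OF smooth_F]] by auto

text \<open>Applied with the metric as \<open>\<Phi>\<close> to obtain metric compatibility, and
  with \<open>christoffel K\<close> as \<open>\<Phi>\<close> to differentiate \<open>cov\<close>
  once more.\<close>

lemma has_derivative_pullback:
  fixes \<Phi> :: "real^'k \<Rightarrow> real^'k \<Rightarrow> real^'k \<Rightarrow> 'd::real_normed_vector"
  assumes x: "x \<in> U" and bil: "\<And>z. z \<in> V \<Longrightarrow> bilinear (\<Phi> z)"
    and d: "\<And>b c. (\<lambda>z. \<Phi> z b c) differentiable (at (F x))"
    and W: "W differentiable (at x)" and Z: "Z differentiable (at x)"
  shows "((\<lambda>y. \<Phi> (F y) (W y) (Z y)) has_derivative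
    (\<lambda>u. ddir (\<lambda>z. \<Phi> z (W x) (Z x)) (F x) (ddir F x u) + \<Phi> (F x) (ddir W x u) (Z x)
      + \<Phi> (F x) (W x) (ddir Z x u))) (at x)"
proof -
  have "(\<lambda>y. \<Phi> (F y) b c) differentiable (at x)" for b c
    by (rule differentiable_compose'[OF F_diff[OF x] d])
  then have "((\<lambda>y. \<Phi> (F y) (W y) (Z y)) has_derivative
    (\<lambda>u. ddir (\<lambda>y. \<Phi> (F y) (W x) (Z x)) x u + \<Phi> (F x) (ddir W x u) (Z x)
      + \<Phi> (F x) (W x) (ddir Z x u))) (at x)"
    by (intro has_derivative_bilinear_family[OF open_U x _ _ W Z, of "\<lambda>y. \<Phi> (F y)"] bil F_in)
  moreover have "ddir (\<lambda>y. \<Phi> (F y) (W x) (Z x)) x u = ddir (\<lambda>z. \<Phi> z (W x) (Z x)) (F x) (ddir F x u)" for u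
    by (rule ddir_compose[OF F_diff[OF x] d])
  ultimately show ?thesis by simp
qed

text \<open>Metric compatibility for constant fields: in the sum of the two Koszul expressions
  everything cancels except twice the derivative along \<open>u\<close>.\<close>

lemma metric_koszul:
  assumes "z \<in> V"
  shows "ddir (\<lambda>y. K y v w) z u = K z (christoffel K z u v) w + K z v (christoffel K z u w)"
  using inner_form.sym[OF inner_form[OF assms], of v "christoffel K z u w"]
    ddir_metric_sym[OF assms, of w v] ddir_metric_sym[OF assms, of u v] ddir_metric_sym[OF assms, of u w]
  by (simp add: christoffel[OF assms] koszul_def field_simps)

lemma cov_metric:
  assumes x: "x \<in> U" and W: "W differentiable (at x)" and Z: "Z differentiable (at x)"
  shows "ddir (\<lambda>y. K (F y) (W y) (Z y)) x u = K (F x) (cov K F W x u) (Z x) + K (F x) (W x) (cov K F Z x u)"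
  using ddir_eqI[OF has_derivative_pullback[OF x bilinear diff[OF F_in[OF x]] W Z], of u]
  by (simp add: cov_def metric_koszul[OF F_in[OF x]] inner_form.simps[OF inner_form[OF F_in[OF x]]])

text \<open>Torsion-freeness along \<open>F\<close>: second derivatives of \<open>F\<close> and
  Christoffel symbols are both symmetric.\<close>

lemma cov_sym:
  assumes x: "x \<in> U"
  shows "cov K F (\<lambda>y. ddir F y v) x u = cov K F (\<lambda>y. ddir F y u) x v"
  unfolding cov_def using ddir_commute[OF open_U x smooth_F, of v u] christoffel_sym[OF F_in[OF x]] by simp

lemma has_derivative_cov:
  assumes x: "x \<in> U" and W: "smooth_on W U"
  shows "((\<lambda>y. cov K F W y v) has_derivative (\<lambda>u. ddir (\<lambda>y. ddir W y v) x u
    + (ddir (\<lambda>z. christoffel K z (ddir F x v) (W x)) (F x) (ddir F x u)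
      + christoffel K (F x) (ddir (\<lambda>y. ddir F y v) x u) (W x)
      + christoffel K (F x) (ddir F x v) (ddir W x u)))) (at x)"
  unfolding cov_def
  by (intro has_derivative_add has_derivative_ddir smooth_on_differentiable[OF smooth_on_ddir[OF W] x]
    has_derivative_pullback[where \<Phi> = "christoffel K" and W = "\<lambda>y. ddir F y v" and Z = W]
    x bilinear_christoffel differentiable_christoffel F_in dF_diff smooth_on_differentiable[OF W])

lemma cov_diff: "x \<in> U \<Longrightarrow> smooth_on W U \<Longrightarrow> (\<lambda>y. cov K F W y v) differentiable (at x)"
  by (rule differentiableI[OF has_derivative_cov])

text \<open>Constant parameter fields commute, so there is no bracket term. Second derivatives of
  \<open>W\<close> and of \<open>F\<close> cancel by symmetry, the terms with a first derivative of
  \<open>W\<close> cancel between the two orders, and the chain rule turns the rest into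
  \<open>riem_curv\<close>.\<close>

lemma cov_commutator:
  assumes x: "x \<in> U" and W: "smooth_on W U"
  shows "cov K F (\<lambda>y. cov K F W y v) x u - cov K F (\<lambda>y. cov K F W y u) x v
    = riem_curv K (F x) (ddir F x u) (ddir F x v) (W x)"
proof -
  have E: "cov K F (\<lambda>y. cov K F W y v) x u = ddir (\<lambda>y. ddir W y v) x u
    + (ddir (\<lambda>z. christoffel K z (ddir F x v) (W x)) (F x) (ddir F x u)
      + christoffel K (F x) (ddir (\<lambda>y. ddir F y v) x u) (W x)
      + christoffel K (F x) (ddir F x v) (ddir W x u))
    + (christoffel K (F x) (ddir F x u) (ddir W x v)
      + christoffel K (F x) (ddir F x u) (christoffel K (F x) (ddir F x v) (W x)))" for u v
    unfolding cov_def[of K F "\<lambda>y. cov K F W y v"] ddir_eqI[OF has_derivative_cov[OF x W]]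
    using bilinear_radd[OF bilinear_christoffel[OF F_in[OF x]]] by (simp add: cov_def)
  show ?thesis
    unfolding E riem_curv_def
    using ddir_commute[OF open_U x W, of u v] ddir_commute[OF open_U x smooth_F, of u v] by simp
qed

text \<open>Both the Gauss equation and the symmetries of the curvature tensor come out of this identity,
  the latter by applying it to the identity map.\<close>

lemma cov_curvature:
  assumes x: "x \<in> U"
  shows "ddir (\<lambda>y. K (F y) (cov K F (\<lambda>y. ddir F y w) y v) (ddir F y z)) x u
      - ddir (\<lambda>y. K (F y) (cov K F (\<lambda>y. ddir F y w) y u) (ddir F y z)) x v
    = K (F x) (riem_curv K (F x) (ddir F x u) (ddir F x v) (ddir F x w)) (ddir F x z)
      + K (F x) (cov K F (\<lambda>y. ddir F y w) x v) (cov K F (\<lambda>y. ddir F y z) x u)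
      - K (F x) (cov K F (\<lambda>y. ddir F y w) x u) (cov K F (\<lambda>y. ddir F y z) x v)"
proof -
  interpret form: inner_form "K (F x)" by (rule inner_form[OF F_in[OF x]])
  have W: "smooth_on (\<lambda>y. ddir F y w) U" by (rule smooth_on_ddir[OF smooth_F])
  have E: "ddir (\<lambda>y. K (F y) (cov K F (\<lambda>y. ddir F y w) y v) (ddir F y z)) x u
    = K (F x) (cov K F (\<lambda>y. cov K F (\<lambda>y. ddir F y w) y v) x u) (ddir F x z)
      + K (F x) (cov K F (\<lambda>y. ddir F y w) x v) (cov K F (\<lambda>y. ddir F y z) x u)" for u v
    by (rule cov_metric[OF x cov_diff[OF x W] dF_diff[OF x]])
  show ?thesis
    unfolding E cov_commutator[OF x W, of v u, symmetric] by (simp add: form.simps)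
qed

end

section \<open>Symmetries of the curvature tensor\<close>

context metric_chart
begin

sublocale ident: chart_map U G U "\<lambda>x. x"
  by unfold_locales (simp_all add: open_dom inner_form smooth)

lemma cov_ident_const: "cov G (\<lambda>x. x) (\<lambda>y. ddir (\<lambda>x. x) y w) x u = christoffel G x u w"
  by (simp add: cov_def)

text \<open>The terms with derivatives of \<open>koszul\<close> are the very ones that
  \<open>cov_curvature\<close> yields for an isometric immersion, so \<open>gauss\<close> is the
  difference of the two identities.\<close>

lemma curvature_koszul:
  assumes x: "x \<in> U"
  shows "G x (riem_curv G x u v w) z = ddir (\<lambda>y. koszul G y v w z) x u - ddir (\<lambda>y. koszul G y u w z) x v
    - G x (christoffel G x v w) (christoffel G x u z) + G x (christoffel G x u w) (christoffel G x v z)"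
proof -
  have "ddir (\<lambda>y. G y (christoffel G y v w) z) x u = ddir (\<lambda>y. koszul G y v w z) x u" for v u
    using ddir_cong_open[OF open_dom x, of "\<lambda>y. G y (christoffel G y v w) z" "\<lambda>y. koszul G y v w z"]
      christoffel by simp
  then show ?thesis
    using ident.cov_curvature[OF x, of w v z u] unfolding cov_ident_const by simp
qed

lemma ddir_koszul:
  assumes x: "x \<in> U"
  shows "ddir (\<lambda>y. koszul G y v w z) x u = (ddir (\<lambda>y. ddir (\<lambda>y. G y w z) y v) x u
    + ddir (\<lambda>y. ddir (\<lambda>y. G y v z) y w) x u - ddir (\<lambda>y. ddir (\<lambda>y. G y v w) y z) x u) / 2"
  unfolding koszul_def
  by (rule ddir_eqI) (intro bounded_linear.has_derivative[OF bounded_linear_divide] has_derivative_add has_derivative_diff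
    has_derivative_ddir smooth_on_differentiable[OF smooth_on_ddir[OF smooth] x])

lemma ddir2_metric_sym:
  assumes x: "x \<in> U"
  shows "ddir (\<lambda>y. ddir (\<lambda>y. G y a b) y v) x u = ddir (\<lambda>y. ddir (\<lambda>y. G y b a) y v) x u"
  using ddir_cong_open[OF open_dom x, of "\<lambda>y. ddir (\<lambda>y. G y a b) y v" "\<lambda>y. ddir (\<lambda>y. G y b a) y v"]
    ddir_metric_sym[of _ a b] by simp

text \<open>The second derivatives of \<open>G y w z\<close> along \<open>u\<close> and
  \<open>v\<close> cancel. What remains shows the symmetries of the tensor, so that pair symmetry
  can be read off without passing through the Bianchi identity.\<close>

lemma curvature_expand:
  assumes x: "x \<in> U"
  shows "G x (riem_curv G x u v w) z =
    (ddir (\<lambda>y. ddir (\<lambda>y. G y v z) y w) x u - ddir (\<lambda>y. ddir (\<lambda>y. G y v w) y z) x u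
      - ddir (\<lambda>y. ddir (\<lambda>y. G y u z) y w) x v + ddir (\<lambda>y. ddir (\<lambda>y. G y u w) y z) x v) / 2
    - G x (christoffel G x v w) (christoffel G x u z) + G x (christoffel G x u w) (christoffel G x v z)"
  using ddir_commute[OF open_dom x smooth, of w z u v]
  unfolding curvature_koszul[OF x] ddir_koszul[OF x] by (simp add: field_simps)

lemma curvature_skew1: "x \<in> U \<Longrightarrow> G x (riem_curv G x v u w) z = - G x (riem_curv G x u v w) z"
  by (simp add: curvature_koszul)

lemma curvature_skew2:
  assumes x: "x \<in> U"
  shows "G x (riem_curv G x u v z) w = - G x (riem_curv G x u v w) z"
  using inner_form.sym[OF inner_form[OF x], of "christoffel G x v z" "christoffel G x u w"]
    inner_form.sym[OF inner_form[OF x], of "christoffel G x u z" "christoffel G x v w"]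
  by (simp add: curvature_expand[OF x] field_simps)

text \<open>Exchanging the pairs permutes the four second-derivative terms, up to symmetry of the
  metric and of second derivatives, and fixes each product of Christoffel symbols.\<close>

lemma curvature_pair_sym:
  assumes x: "x \<in> U"
  shows "G x (riem_curv G x w z u) v = G x (riem_curv G x u v w) z"
proof -
  have D: "ddir (\<lambda>y. ddir (\<lambda>y. G y a b) y p) x q = ddir (\<lambda>y. ddir (\<lambda>y. G y b a) y q) x p" for a b p q
    using ddir2_metric_sym[OF x, of a b p q] ddir_commute[OF open_dom x smooth, of b a p q] by simp
  have S: "G x (christoffel G x a b) (christoffel G x c d) = G x (christoffel G x d c) (christoffel G x b a)" for a b c d
    using inner_form.sym[OF inner_form[OF x]] christoffel_sym[OF x] by metis
  show ?thesis
    unfolding curvature_expand[OF x] D[of z v u w] D[of z u v w] D[of w v u z] D[of w u v z]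
      S[of z u w v] S[of w u z v]
    using christoffel_sym[OF x] inner_form.sym[OF inner_form[OF x]] by (simp add: field_simps)
qed

lemma linear_curvature:
  assumes x: "x \<in> U"
  shows "linear (riem_curv G x u v)"
proof -
  note bil = bilinear_christoffel
  have l: "linear (\<lambda>w. ddir (\<lambda>y. christoffel G y v w) x u)" for u v
    by (rule linear_ddir_family[OF open_dom x]) (use bil differentiable_christoffel[OF x] in \<open>auto simp: bilinear_def\<close>)
  note r = bilinear_radd[OF bil[OF x]] bilinear_rmul[OF bil[OF x]]
  show ?thesis
    unfolding riem_curv_def
    by (rule linearI) (simp_all add: linear_add[OF l] linear_cmul[OF l] r algebra_simps)
qed

text \<open>The last two arguments are handled directly; pair symmetry carries linearity over to the
  first two.\<close>

lemma linear_curvature_form: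
  assumes x: "x \<in> U"
  shows "linear (\<lambda>u. G x (riem_curv G x u v w) z)" "linear (\<lambda>v. G x (riem_curv G x u v w) z)"
    "linear (\<lambda>w. G x (riem_curv G x u v w) z)" "linear (\<lambda>z. G x (riem_curv G x u v w) z)"
proof -
  interpret inner_form "G x" by (rule inner_form[OF x])
  have l: "linear (\<lambda>w. G x (riem_curv G x u v w) z)" for u v z
    using linear_compose[OF linear_curvature[OF x] linear_left] by (simp add: o_def)
  show "linear (\<lambda>w. G x (riem_curv G x u v w) z)" "linear (\<lambda>z. G x (riem_curv G x u v w) z)" for u v w z
    by (rule l) (rule linear_right)
  show "linear (\<lambda>u. G x (riem_curv G x u v w) z)"
    using l[of w z v] by (simp add: curvature_pair_sym[OF x, of w z])
  show "linear (\<lambda>v. G x (riem_curv G x u v w) z)"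
    using linear_right[of "riem_curv G x w z u"] unfolding curvature_pair_sym[OF x, of w z] .
qed

end

section \<open>Quadratic forms and orthonormal frames\<close>

lemma vec_expand: "(u :: real^'n) = (\<Sum>i\<in>UNIV. u $ i *\<^sub>R axis i 1)"
  using basis_expansion[of u] by (simp add: scalar_mult_eq_scaleR)

lemma linear_expand_vec:
  fixes \<phi> :: "real^'n \<Rightarrow> real"
  assumes "linear \<phi>"
  shows "\<phi> u = (\<Sum>i\<in>UNIV. u $ i * \<phi> (axis i 1))"
  using arg_cong[OF vec_expand[of u], of \<phi>] by (simp add: linear_sum[OF assms] linear_cmul[OF assms])

lemma sum_UNIV_pair:
  fixes f :: "'a::finite \<times> 'b::finite \<Rightarrow> 'c::comm_monoid_add"
  shows "(\<Sum>I\<in>UNIV. f I) = (\<Sum>i\<in>UNIV. \<Sum>j\<in>UNIV. f (i, j))"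
  by (simp add: sum.cartesian_product)

text \<open>The Rayleigh quotient attains its minimum on the compact unit sphere of
  \<open>W\<close>, and the first variation there shows that a minimizer is an eigenvector. So the
  minimum is an eigenvalue, to which \<open>ev\<close> applies.\<close>

lemma (in inner_form) quadratic_bounded_below:
  assumes W: "subspace W" and L: "linear L" "L ` W \<subseteq> W"
    and L_sym: "\<And>x y. x \<in> W \<Longrightarrow> y \<in> W \<Longrightarrow> k (L x) y = k (L y) x"
    and ev: "\<And>ev x. x \<in> W \<Longrightarrow> x \<noteq> 0 \<Longrightarrow> L x = ev *\<^sub>R x \<Longrightarrow> c \<le> ev"
    and x: "x \<in> W"
  shows "c * k x x \<le> k (L x) x"
proof (cases "W = {0}")
  case True
  then show ?thesis using x by (simp add: simps)
next
  case False
  define q where "q y = k (L y) y / k y y" for y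
  have qpos: "0 < k y y" if "norm y = 1" for y using that by (intro pos) auto
  have "continuous_on (W \<inter> sphere 0 1) q"
    unfolding q_def using qpos
    by (intro continuous_on_divide bilinear_continuous_on_compose[OF _ _ bil] linear_continuous_on
        linear_conv_bounded_linear[THEN iffD1] L(1) continuous_on_id) force
  moreover have "compact (W \<inter> sphere 0 1)"
    by (intro closed_Int_compact closed_subspace W compact_sphere)
  moreover have "W \<inter> sphere 0 1 \<noteq> {}"
  proof -
    obtain w where "w \<in> W" "w \<noteq> 0" using False subspace_0[OF W] by blast
    then have "(1 / norm w) *\<^sub>R w \<in> W \<inter> sphere 0 1" using subspace_scale[OF W] by simp
    then show ?thesis by blast
  qed
  ultimately obtain x0 where "x0 \<in> W \<inter> sphere 0 1" and "\<forall>y\<in>W \<inter> sphere 0 1. q x0 \<le> q y"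
    using continuous_attains_inf[of "W \<inter> sphere 0 1" q] by blast
  then have x0: "x0 \<in> W" "norm x0 = 1" and min: "\<And>y. y \<in> W \<Longrightarrow> norm y = 1 \<Longrightarrow> q x0 \<le> q y"
    by (auto simp: dist_norm)
  define ev where "ev = q x0"
  define d where "d y = k (L y) y - ev * k y y" for y
  have lin: "L (a + b) = L a + L b" "L (r *\<^sub>R a) = r *\<^sub>R L a" "L 0 = 0" for a b r
    using L(1) by (simp_all add: linear_add linear_cmul linear_0)
  have d_nonneg: "0 \<le> d y" if y: "y \<in> W" for y
  proof (cases "y = 0")
    case False
    define z where "z = (1 / norm y) *\<^sub>R y"
    have z: "z \<in> W" "norm z = 1" and yz: "y = norm y *\<^sub>R z"
      using False y subspace_scale[OF W] by (auto simp: z_def)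
    have "ev \<le> k (L z) z / k z z" using min[OF z] by (simp add: ev_def q_def)
    then have "ev * k z z \<le> k (L z) z" using qpos[OF z(2)] by (simp add: pos_le_divide_eq)
    then have "0 \<le> norm y * norm y * (k (L z) z - ev * k z z)" by simp
    also have "\<dots> = d (norm y *\<^sub>R z)" by (simp add: d_def lin simps algebra_simps)
    finally show ?thesis using yz by simp
  qed (simp add: d_def simps)
  \<comment> \<open>The residual of the eigenvalue equation. If it were nonzero, a small step from
    \<open>x0\<close> against it would make the nonnegative form \<open>d\<close> negative, since
    \<open>d\<close> vanishes at \<open>x0\<close> with first variation \<open>2 * k v v\<close>
    along \<open>v\<close>.\<close>
  define v where "v = L x0 - ev *\<^sub>R x0"
  have v: "v \<in> W" unfolding v_def using x0 L(2) by (intro subspace_diff subspace_scale W) auto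
  have "v = 0"
  proof (rule ccontr)
    assume "v \<noteq> 0"
    then have N: "0 < k v v" by (rule pos)
    have Q: "0 \<le> d v" by (rule d_nonneg[OF v])
    have dx0: "d x0 = 0" using qpos[OF x0(2)] by (simp add: d_def ev_def q_def)
    have e: "d (x0 + t *\<^sub>R v) = 2 * t * k v v + t * t * d v" for t
    proof -
      have "d (x0 + t *\<^sub>R v) = d x0 + 2 * t * (k (L x0) v - ev * k x0 v) + t * t * d v"
        using L_sym[OF v x0(1)] sym[of v x0] by (simp add: d_def lin simps algebra_simps)
      also have "k (L x0) v - ev * k x0 v = k v v"
        using sym[of x0 "L x0"] by (simp add: v_def simps algebra_simps)
      finally show ?thesis by (simp add: dx0)
    qed
    \<comment> \<open>Chosen such that \<open>2 * k v v + t * d v\<close> becomes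
      \<open>k v v - t\<close>, which is positive; the summand 1 avoids a zero denominator.\<close>
    define t where "t = - k v v / (d v + 1)"
    have t: "t < 0" "t * (d v + 1) = - k v v" using N Q by (auto simp: t_def divide_simps)
    have "d (x0 + t *\<^sub>R v) = t * (2 * k v v + t * d v)" unfolding e by (simp add: algebra_simps)
    also have "2 * k v v + t * d v = k v v - t" using t(2) by (simp add: algebra_simps)
    also have "t * (k v v - t) < 0" using t(1) N by (intro mult_neg_pos) auto
    finally have "d (x0 + t *\<^sub>R v) < 0" .
    moreover have "x0 + t *\<^sub>R v \<in> W" using x0 v by (intro subspace_add subspace_scale W)
    ultimately show False using d_nonneg by force
  qed
  then have "L x0 = ev *\<^sub>R x0" by (simp add: v_def)
  moreover have "x0 \<noteq> 0" using x0(2) by auto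
  ultimately have "c \<le> ev" using ev[OF x0(1)] by blast
  then have "c * k x x \<le> ev * k x x" using nonneg[of x] by (rule mult_right_mono)
  then show ?thesis using d_nonneg[OF x] by (simp add: d_def)
qed

text \<open>The tensor product of two vectors. Forms on matrices are evaluated on these first and
  then antisymmetrized by \<open>wedge_tens\<close>.\<close>

definition tens :: "real^'n \<Rightarrow> real^'n \<Rightarrow> real^'n^'n" where
  "tens u v = (\<chi> i j. u $ i * v $ j)"

lemma wedge_tens: "wedge u v = tens u v - tens v u"
  by (simp add: wedge_def tens_def vec_eq_iff)

locale vec_inner_form = inner_form k for k :: "real^'n::finite \<Rightarrow> real^'n \<Rightarrow> real"
begin

text \<open>Gram-Schmidt, by induction over finite sets of indices, because a frame is indexed by
  the type \<open>'n\<close> itself. As long as an index is missing, a dimension count supplies a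
  vector outside the span.\<close>

lemma ex_orthonormal_frame: "\<exists>e. orthonormal_frame k e"
proof -
  have "\<exists>e. \<forall>i\<in>I. \<forall>j\<in>I. k (e i) (e j) = (if i = j then 1 else 0)" for I :: "'n set"
    using finite[of I]
  proof (induction I)
    case (insert i0 I)
    then obtain e where e: "\<And>i j. i \<in> I \<Longrightarrow> j \<in> I \<Longrightarrow> k (e i) (e j) = (if i = j then 1 else 0)" by blast
    have "dim (e ` I) \<le> card I"
      using dim_le_card'[of "e ` I"] card_image_le[of I e] insert.hyps(1) by force
    also have "card I < CARD('n)"
      using insert.hyps(2) by (intro psubset_card_mono) auto
    finally have "span (e ` I) \<noteq> (UNIV :: (real^'n) set)"
      by (metis DIM_cart DIM_real dim_UNIV dim_span mult.right_neutral nat_less_le)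
    then obtain v where v: "v \<notin> span (e ` I)" by blast
    define w where "w = v - (\<Sum>i\<in>I. k v (e i) *\<^sub>R e i)"
    have "(\<Sum>i\<in>I. k v (e i) *\<^sub>R e i) \<in> span (e ` I)"
      by (intro span_sum span_scale span_base) auto
    then have "w \<noteq> 0" using v by (auto simp: w_def)
    then have ww: "0 < k w w" by (rule pos)
    have wj: "k w (e j) = 0" if "j \<in> I" for j
    proof -
      have "(\<Sum>i\<in>I. k v (e i) * k (e i) (e j)) = (\<Sum>i\<in>I. if i = j then k v (e i) else 0)"
        by (rule sum.cong) (use e that in auto)
      then show ?thesis using that insert.hyps(1) by (simp add: w_def simps sum_left)
    qed
    then have jw: "k (e j) w = 0" if "j \<in> I" for j using sym that by simp
    show ?case
      by (rule exI[of _ "e(i0 := (1 / sqrt (k w w)) *\<^sub>R w)"])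
        (use e wj jw ww insert.hyps(2) in \<open>auto simp: simps\<close>)
  qed simp
  from this[of UNIV] show ?thesis by (auto simp: orthonormal_frame_def)
qed

lemma frameD: "orthonormal_frame k e \<Longrightarrow> k (e i) (e j) = (if i = j then 1 else 0)"
  unfolding orthonormal_frame_def by blast

lemma frame_expand:
  assumes "orthonormal_frame k e"
  shows "u = (\<Sum>i\<in>UNIV. k u (e i) *\<^sub>R e i)"
proof -
  define T where "T c = (\<Sum>i\<in>UNIV. c $ i *\<^sub>R e i)" for c :: "real^'n"
  have Tj: "k (T c) (e j) = c $ j" for c j
    by (simp add: T_def sum_left simps frameD[OF assms] if_distrib cong: if_cong)
  have "linear T" by (rule linearI) (simp_all add: T_def scaleR_add_left sum.distrib scaleR_sum_right)
  moreover have "inj T" by (rule injI) (metis Tj vec_eq_iff)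
  ultimately have "surj T" by (rule linear_injective_imp_surjective) simp
  then obtain c where c: "u = T c" by (metis surjD)
  show ?thesis unfolding c Tj by (simp add: T_def)
qed

lemma frame_parseval:
  assumes "orthonormal_frame k e"
  shows "k u v = (\<Sum>i\<in>UNIV. k u (e i) * k v (e i))"
  using arg_cong[OF frame_expand[OF assms, of v], of "k u"] by (simp add: sum_right simps mult.commute)

section \<open>Bivectors\<close>

lemma expand2: "k u v = (\<Sum>i\<in>UNIV. \<Sum>j\<in>UNIV. u $ i * v $ j * k (axis i 1) (axis j 1))"
  using bilinear_sum[OF bil, of "\<lambda>i. u $ i *\<^sub>R axis i 1" UNIV "\<lambda>i. v $ i *\<^sub>R axis i 1" UNIV]
  by (simp add: vec_expand[symmetric] sum.cartesian_product simps split_def ac_simps)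

text \<open>With index pairs the fourfold sum becomes a double sum, the form of a Gram matrix on the
  tensor square.\<close>

lemma bivector_inner_pairs:
  "bivector_inner k B C = (\<Sum>I\<in>UNIV. \<Sum>J\<in>UNIV. B $ fst I $ snd I * C $ fst J $ snd J *
     (k (axis (fst I) 1) (axis (fst J) 1) * k (axis (snd I) 1) (axis (snd J) 1))) / 2"
  unfolding bivector_inner_def sum_UNIV_pair by (simp add: mult.assoc)

lemma bivector_inner_tens: "bivector_inner k (tens u v) (tens z w) = k u z * k v w / 2"
proof -
  have "k u z * k v w = (\<Sum>i\<in>UNIV. \<Sum>j\<in>UNIV. (\<Sum>p\<in>UNIV. u $ i * z $ p * k (axis i 1) (axis p 1)) *
      (\<Sum>q\<in>UNIV. v $ j * w $ q * k (axis j 1) (axis q 1)))"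
    unfolding expand2[of u z] expand2[of v w] by (simp add: sum_product)
  also have "\<dots> = (\<Sum>i\<in>UNIV. \<Sum>j\<in>UNIV. \<Sum>p\<in>UNIV. \<Sum>q\<in>UNIV.
      u $ i * z $ p * k (axis i 1) (axis p 1) * (v $ j * w $ q * k (axis j 1) (axis q 1)))"
    by (simp add: sum_product)
  finally show ?thesis by (simp add: bivector_inner_def tens_def ac_simps)
qed

text \<open>Positivity holds on all matrices: in an orthonormal frame the form is half the sum of
  the squared components.\<close>

lemma inner_form_bivector: "inner_form (bivector_inner k)"
proof
  have "linear (\<lambda>B. bivector_inner k B C)" "linear (bivector_inner k C)" for C
    unfolding bivector_inner_pairs
    by (auto intro!: linearI simp: distrib_left distrib_right sum.distrib add_divide_distrib sum_distrib_left sum_divide_distrib ac_simps)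
  then show "bilinear (bivector_inner k)" by (simp add: bilinear_def)
  show "bivector_inner k B C = bivector_inner k C B" for B C
    unfolding bivector_inner_pairs using sym by (subst sum.swap) (simp add: ac_simps)
  fix B :: "real^'n^'n" assume "B \<noteq> 0"
  obtain e where e: "orthonormal_frame k e" using ex_orthonormal_frame by blast
  \<comment> \<open>The change from the standard basis to the frame, on tensor squares; the
    \<open>\<beta> A\<close> are then the components of \<open>B\<close> in the frame.\<close>
  define P where "P I A = k (axis (fst I) 1) (e (fst A)) * k (axis (snd I) 1) (e (snd A))" for I A
  define \<beta> where "\<beta> A = (\<Sum>I\<in>UNIV. B $ fst I $ snd I * P I A)" for A
  have P: "k (axis (fst I) 1) (axis (fst J) 1) * k (axis (snd I) 1) (axis (snd J) 1) = (\<Sum>A\<in>UNIV. P I A * P J A)" for I J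
    unfolding frame_parseval[OF e, of "axis (fst I) 1" "axis (fst J) 1"] frame_parseval[OF e, of "axis (snd I) 1" "axis (snd J) 1"]
    unfolding sum_product sum_UNIV_pair by (simp add: P_def ac_simps)
  have "bivector_inner k B B = (\<Sum>I\<in>UNIV. \<Sum>J\<in>UNIV. \<Sum>A\<in>UNIV. (B $ fst I $ snd I * P I A) * (B $ fst J $ snd J * P J A)) / 2"
    unfolding bivector_inner_pairs P by (simp add: sum_distrib_left ac_simps)
  also have "\<dots> = (\<Sum>A\<in>UNIV. \<Sum>I\<in>UNIV. \<Sum>J\<in>UNIV. (B $ fst I $ snd I * P I A) * (B $ fst J $ snd J * P J A)) / 2"
    by (subst (2) sum.swap, subst sum.swap) simp
  also have "\<dots> = (\<Sum>A\<in>UNIV. (\<beta> A)\<^sup>2) / 2"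
    by (simp add: \<beta>_def power2_eq_square sum_product)
  finally have eq: "bivector_inner k B B = (\<Sum>A\<in>UNIV. (\<beta> A)\<^sup>2) / 2" .
  have "\<exists>A. \<beta> A \<noteq> 0"
  proof (rule ccontr)
    assume "\<not> ?thesis"
    then have 0: "\<beta> (a, b) = 0" for a b by blast
    have zero: "c = 0" if "\<And>a. k c (e a) = 0" for c
      by (subst frame_expand[OF e]) (simp add: that)
    \<comment> \<open>Contracts only the second index of \<open>B\<close> with the frame, so that
      nondegeneracy can be used on one index at a time.\<close>
    define row :: "'n \<Rightarrow> real^'n" where "row b = (\<Sum>i\<in>UNIV. (\<Sum>j\<in>UNIV. B $ i $ j * k (axis j 1) (e b)) *\<^sub>R axis i 1)" for b
    have "k (row b) (e a) = \<beta> (a, b)" for a b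
      by (simp add: row_def \<beta>_def P_def sum_UNIV_pair sum_left simps sum_distrib_left sum_distrib_right ac_simps)
    then have "row b = 0" for b using 0 zero by simp
    moreover have "row b $ i = (\<Sum>j\<in>UNIV. B $ i $ j * k (axis j 1) (e b))" for b i
      using vec_expand[of "\<chi> i. \<Sum>j\<in>UNIV. B $ i $ j * k (axis j 1) (e b)", symmetric] by (simp add: row_def)
    ultimately have "(\<Sum>j\<in>UNIV. B $ i $ j * k (axis j 1) (e b)) = 0" for i b
      by (metis zero_index)
    then have "k (B $ i) (e b) = 0" for i b
      using arg_cong[OF vec_expand[of "B $ i"], of "\<lambda>u. k u (e b)"] by (simp add: sum_left simps)
    then have "B $ i = 0" for i using zero by blast
    then show False using \<open>B \<noteq> 0\<close> by (simp add: vec_eq_iff)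
  qed
  then have "0 < (\<Sum>A\<in>UNIV. (\<beta> A)\<^sup>2)"
    by (metis finite iso_tuple_UNIV_I sum_pos2 zero_le_power2 zero_less_power2)
  then show "0 < bivector_inner k B B" by (simp add: eq)
qed

sublocale biv: inner_form "bivector_inner k"
  by (rule inner_form_bivector)

text \<open>The four products of \<open>tens\<close> terms agree in pairs, which offsets the factor
  1/2 in \<open>bivector_inner\<close>.\<close>

lemma bivector_inner_wedge:
  "bivector_inner k (wedge u v) (wedge z w) = k u z * k v w - k u w * k v z"
  by (simp add: wedge_tens biv.simps bivector_inner_tens field_simps)

end

lemma wedge_bivector: "wedge u v \<in> bivectors"
  by (simp add: bivectors_def wedge_def transpose_def vec_eq_iff)

lemma bivectors_iff: "B \<in> bivectors \<longleftrightarrow> (\<forall>i j. B $ j $ i = - (B $ i $ j))"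
  by (simp add: bivectors_def transpose_def vec_eq_iff)

lemma subspace_bivectors: "subspace bivectors"
  unfolding subspace_def
proof (intro conjI ballI allI)
  fix B C :: "real^'n^'n" and r :: real
  assume B: "B \<in> bivectors"
  then have b: "B $ j $ i = - (B $ i $ j)" for i j unfolding bivectors_iff by blast
  show "r *\<^sub>R B \<in> bivectors"
    unfolding bivectors_iff
  proof (intro allI)
    show "(r *\<^sub>R B) $ j $ i = - ((r *\<^sub>R B) $ i $ j)" for i j using b[of j i] by simp
  qed
  assume "C \<in> bivectors"
  then have c: "C $ j $ i = - (C $ i $ j)" for i j unfolding bivectors_iff by blast
  show "B + C \<in> bivectors"
    unfolding bivectors_iff
  proof (intro allI)
    show "(B + C) $ j $ i = - ((B + C) $ i $ j)" for i j using b[of j i] c[of j i] by simp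
  qed
qed (simp add: bivectors_iff)

text \<open>The factor 1/2 appears because every unordered pair of indices is counted twice.\<close>

lemma bivector_expand:
  fixes B :: "real^'n^'n"
  assumes "B \<in> bivectors"
  shows "B = (\<Sum>i\<in>UNIV. \<Sum>j\<in>UNIV. (B $ i $ j / 2) *\<^sub>R wedge (axis i 1) (axis j 1))"
proof -
  have "(\<Sum>i\<in>UNIV. \<Sum>j\<in>UNIV. (B $ i $ j / 2) *\<^sub>R wedge (axis i 1) (axis j 1)) $ p $ q
    = B $ p $ q" for p q
  proof -
    have "(\<Sum>i\<in>UNIV. \<Sum>j\<in>UNIV. (B $ i $ j / 2) *\<^sub>R wedge (axis i 1) (axis j 1)) $ p $ q
      = (\<Sum>i\<in>UNIV. \<Sum>j\<in>UNIV. (if i = p then if j = q then B $ p $ q / 2 else 0 else 0)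
        - (if i = q then if j = p then B $ q $ p / 2 else 0 else 0))"
      unfolding sum_component vector_scaleR_component wedge_def axis_def
      by (intro sum.cong refl) (simp add: field_simps)
    also have "\<dots> = B $ p $ q / 2 - B $ q $ p / 2"
    proof -
      have if_sum: "(\<Sum>j\<in>UNIV. if i = s then f j else 0) = (if i = s then \<Sum>j\<in>UNIV. f j else 0)"
        for i s :: 'n and f :: "'n \<Rightarrow> real" by simp
      show ?thesis unfolding sum_subtractf if_sum by simp
    qed
    also have "\<dots> = B $ p $ q"
    proof -
      have "B $ q $ p = - (B $ p $ q)" using assms unfolding bivectors_iff by blast
      then show ?thesis by simp
    qed
    finally show ?thesis .
  qed
  then show ?thesis by (simp add: vec_eq_iff)
qed

lemma linear_eq_on_bivectors:
  fixes \<phi> \<psi> :: "real^'n^'n \<Rightarrow> 'b::real_vector"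
  assumes "linear \<phi>" "linear \<psi>" "\<And>u v. \<phi> (wedge u v) = \<psi> (wedge u v)" "B \<in> bivectors"
  shows "\<phi> B = \<psi> B"
  by (subst (1 2) bivector_expand[OF assms(4)])
    (simp add: assms(3) linear_sum[OF assms(1)] linear_sum[OF assms(2)] linear_cmul[OF assms(1)] linear_cmul[OF assms(2)])

section \<open>The curvature operator\<close>

context vec_inner_form
begin

text \<open>Shows that the \<open>SOME\<close> in \<open>curvature_operator\<close> has a candidate.
  \<open>Rm\<close> extends to a bilinear form \<open>\<rho>\<close> on all matrices, which
  \<open>bivector_inner k\<close> represents by an operator.\<close>

lemma ex_bivector_operator:
  fixes Rm :: "real^'n \<Rightarrow> real^'n \<Rightarrow> real^'n \<Rightarrow> real^'n \<Rightarrow> real"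
  assumes lin: "\<And>v w z. linear (\<lambda>u. Rm u v w z)" "\<And>u w z. linear (\<lambda>v. Rm u v w z)"
      "\<And>u v z. linear (\<lambda>w. Rm u v w z)" "\<And>u v w. linear (\<lambda>z. Rm u v w z)"
    and skew: "\<And>u v w z. Rm v u w z = - Rm u v w z" "\<And>u v w z. Rm u v z w = - Rm u v w z"
  shows "\<exists>L. linear L \<and> L ` bivectors \<subseteq> bivectors \<and>
    (\<forall>u v z w. bivector_inner k (L (wedge u v)) (wedge z w) = Rm u v w z)"
proof -
  \<comment> \<open>The last two indices are reversed because z \<and> w is paired with
    \<open>Rm u v w z\<close>. On two wedges four equal terms arise, whence the division by
    4.\<close>
  define \<rho> where "\<rho> B C = (\<Sum>i\<in>UNIV. \<Sum>j\<in>UNIV. \<Sum>p\<in>UNIV. \<Sum>q\<in>UNIV.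
    B $ i $ j * C $ p $ q * Rm (axis i 1) (axis j 1) (axis q 1) (axis p 1)) / 4" for B C :: "real^'n^'n"
  have \<rho>_lin: "linear (\<lambda>B. \<rho> B C)" "linear (\<rho> C)" for C
    unfolding \<rho>_def
    by (auto intro!: linearI simp: distrib_left distrib_right sum.distrib add_divide_distrib sum_distrib_left sum_divide_distrib ac_simps)
  have \<rho>_tens: "\<rho> (tens u v) (tens z w) = Rm u v w z / 4" for u v z w
  proof -
    have e: "Rm u v w z = (\<Sum>i\<in>UNIV. u $ i * Rm (axis i 1) v w z)"
      "Rm u v w z = (\<Sum>i\<in>UNIV. v $ i * Rm u (axis i 1) w z)"
      "Rm u v w z = (\<Sum>i\<in>UNIV. w $ i * Rm u v (axis i 1) z)"
      "Rm u v w z = (\<Sum>i\<in>UNIV. z $ i * Rm u v w (axis i 1))" for u v w z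
      by (rule linear_expand_vec[OF lin(1)] linear_expand_vec[OF lin(2)]
          linear_expand_vec[OF lin(3)] linear_expand_vec[OF lin(4)])+
    have "Rm u v w z = (\<Sum>i\<in>UNIV. \<Sum>j\<in>UNIV. \<Sum>p\<in>UNIV. \<Sum>q\<in>UNIV.
        u $ i * (v $ j * (z $ p * (w $ q * Rm (axis i 1) (axis j 1) (axis q 1) (axis p 1)))))"
      unfolding e(1)[of u v w z] unfolding e(2)[of _ v w z] unfolding e(4)[of _ _ w z] unfolding e(3)[of _ _ w]
      by (simp only: sum_distrib_left)
    then show ?thesis by (simp add: \<rho>_def tens_def ac_simps)
  qed
  define L where "L B = (THE X. \<forall>C. bivector_inner k X C = \<rho> B C)" for B
  have L: "bivector_inner k (L B) C = \<rho> B C" for B C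
    using theI'[OF biv.ex1_represent[OF \<rho>_lin(2), of B]] unfolding L_def by blast
  have "linear L"
    by (intro linearI biv.eqI) (simp_all add: L biv.simps linear_add[OF \<rho>_lin(1)] linear_cmul[OF \<rho>_lin(1)])
  \<comment> \<open>Transposition is self-adjoint for \<open>bivector_inner k\<close>, and
    \<open>\<rho> B\<close> changes sign under it, so \<open>L B\<close> is skew for every matrix
    \<open>B\<close>.\<close>
  moreover have "L B \<in> bivectors" for B
  proof -
    have T: "bivector_inner k (transpose X) C = bivector_inner k X (transpose C)" for X C
    proof -
      have "(\<Sum>i\<in>UNIV. \<Sum>j\<in>UNIV. \<Sum>p\<in>UNIV. \<Sum>q\<in>UNIV. X $ j $ i * C $ p $ q * k (axis i 1) (axis p 1) * k (axis j 1) (axis q 1))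
        = (\<Sum>j\<in>UNIV. \<Sum>i\<in>UNIV. \<Sum>p\<in>UNIV. \<Sum>q\<in>UNIV. X $ j $ i * C $ p $ q * k (axis i 1) (axis p 1) * k (axis j 1) (axis q 1))"
        by (rule sum.swap)
      also have "\<dots> = (\<Sum>j\<in>UNIV. \<Sum>i\<in>UNIV. \<Sum>q\<in>UNIV. \<Sum>p\<in>UNIV. X $ j $ i * C $ p $ q * k (axis i 1) (axis p 1) * k (axis j 1) (axis q 1))"
        by (rule sum.cong[OF refl], rule sum.cong[OF refl], rule sum.swap)
      finally show ?thesis by (simp add: bivector_inner_def transpose_def ac_simps)
    qed
    have R: "\<rho> B (transpose C) = - \<rho> B C" for C
    proof -
      have "\<rho> B (transpose C) = (\<Sum>i\<in>UNIV. \<Sum>j\<in>UNIV. \<Sum>p\<in>UNIV. \<Sum>q\<in>UNIV.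
          - (B $ i $ j * C $ q $ p * Rm (axis i 1) (axis j 1) (axis p 1) (axis q 1))) / 4"
        unfolding \<rho>_def transpose_def
        by (intro arg_cong[where f = "\<lambda>t. t / 4"] sum.cong refl) (subst skew(2), simp)
      also have "\<dots> = (\<Sum>i\<in>UNIV. \<Sum>j\<in>UNIV. \<Sum>q\<in>UNIV. \<Sum>p\<in>UNIV.
          - (B $ i $ j * C $ q $ p * Rm (axis i 1) (axis j 1) (axis p 1) (axis q 1))) / 4"
        by (rule arg_cong[where f = "\<lambda>t. t / 4"], rule sum.cong[OF refl], rule sum.cong[OF refl], rule sum.swap)
      finally show ?thesis by (simp add: \<rho>_def sum_negf)
    qed
    have "transpose (L B) = - L B"
      by (rule biv.eqI) (simp add: T L R biv.simps)
    then show ?thesis by (simp add: bivectors_def)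
  qed
  moreover have "bivector_inner k (L (wedge u v)) (wedge z w) = Rm u v w z" for u v z w
  proof -
    have "\<rho> (wedge u v) (wedge z w) = (Rm u v w z - Rm u v z w - (Rm v u w z - Rm v u z w)) / 4"
      unfolding wedge_tens linear_diff[OF \<rho>_lin(1)] linear_diff[OF \<rho>_lin(2)] \<rho>_tens
      by (simp add: diff_divide_distrib)
    then show ?thesis using skew(1)[of u v] skew(2)[of u v z w] skew(2)[of v u z w] by (simp add: L)
  qed
  ultimately show ?thesis by blast
qed

text \<open>On wedges this is pair symmetry of \<open>Rm\<close>; linearity extends it to bivectors
  in one argument at a time.\<close>

lemma bivector_operator_self_adjoint:
  assumes L: "linear L"
    and Rm: "\<And>u v z w. bivector_inner k (L (wedge u v)) (wedge z w) = Rm u v w z"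
    and sym: "\<And>u v w z. Rm z w v u = Rm u v w z"
    and B: "B \<in> bivectors" and C: "C \<in> bivectors"
  shows "bivector_inner k (L B) C = bivector_inner k (L C) B"
proof -
  have l: "linear (\<lambda>B. bivector_inner k (L B) C)" "linear (\<lambda>C. bivector_inner k (L B) C)" for B C
    using linear_compose[OF L biv.linear_left] biv.linear_right by (simp_all add: o_def)
  have 1: "bivector_inner k (L (wedge u v)) C = bivector_inner k (L C) (wedge u v)" for u v
    by (rule linear_eq_on_bivectors[OF l(2) l(1) _ C]) (simp add: Rm sym[of u])
  show ?thesis
    by (rule linear_eq_on_bivectors[OF l(1) l(2) _ B]) (rule 1)
qed

end

context metric_chart
begin

lemma vec_inner_form: "x \<in> U \<Longrightarrow> vec_inner_form (G x)"
  by (rule vec_inner_form.intro[OF inner_form])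

lemma curvature_operator:
  assumes x: "x \<in> U"
  shows "linear (curvature_operator G x)" "curvature_operator G x ` bivectors \<subseteq> bivectors"
    "bivector_inner (G x) (curvature_operator G x (wedge u v)) (wedge z w) = G x (riem_curv G x u v w) z"
proof -
  interpret vec_inner_form "G x" by (rule vec_inner_form[OF x])
  have "\<exists>L. linear L \<and> L ` bivectors \<subseteq> bivectors \<and>
    (\<forall>u v z w. bivector_inner (G x) (L (wedge u v)) (wedge z w) = G x (riem_curv G x u v w) z)"
    by (rule ex_bivector_operator[where Rm = "\<lambda>u v w z. G x (riem_curv G x u v w) z"])
      (fact linear_curvature_form[OF x] curvature_skew1[OF x] curvature_skew2[OF x])+
  from someI_ex[OF this]
  show "linear (curvature_operator G x)" "curvature_operator G x ` bivectors \<subseteq> bivectors"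
    "bivector_inner (G x) (curvature_operator G x (wedge u v)) (wedge z w) = G x (riem_curv G x u v w) z"
    unfolding curvature_operator_def by blast+
qed

text \<open>Both sides are quadratic in \<Omega> = u \<and> v - z \<and> w: \<open>c\<close> times
  its squared length, and the curvature form evaluated on it.\<close>

lemma curvature_wedge_diff_ge:
  assumes x: "x \<in> U"
    and ev: "\<forall>ev. (\<exists>B\<in>bivectors. B \<noteq> 0 \<and> curvature_operator G x B = ev *\<^sub>R B) \<longrightarrow> c \<le> ev"
  shows "c * (G x u u * G x v v - (G x u v)\<^sup>2 + (G x z z * G x w w - (G x z w)\<^sup>2)
      - 2 * (G x u z * G x v w - G x u w * G x v z))
    \<le> G x (riem_curv G x u v v) u - G x (riem_curv G x u v w) z
      - G x (riem_curv G x z w v) u + G x (riem_curv G x z w w) z"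
proof -
  interpret vec_inner_form "G x" by (rule vec_inner_form[OF x])
  define \<Omega> where "\<Omega> = wedge u v - wedge z w"
  note op = curvature_operator[OF x]
  have \<Omega>: "\<Omega> \<in> bivectors"
    unfolding \<Omega>_def by (intro subspace_diff[OF subspace_bivectors] wedge_bivector)
  have "G x (riem_curv G x z w v) u = G x (riem_curv G x u v w) z" for u v z w
    using curvature_pair_sym[OF x, of w z u v] curvature_skew1[OF x, of z w v u]
      curvature_skew2[OF x, of w z u v] by simp
  then have "c * bivector_inner (G x) \<Omega> \<Omega> \<le> bivector_inner (G x) (curvature_operator G x \<Omega>) \<Omega>"
    using ev by (intro biv.quadratic_bounded_below[OF subspace_bivectors op(1,2) _ _ \<Omega>]
        bivector_operator_self_adjoint[OF op(1) op(3)]) blast+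
  also have "bivector_inner (G x) (curvature_operator G x \<Omega>) \<Omega> = G x (riem_curv G x u v v) u - G x (riem_curv G x u v w) z
      - G x (riem_curv G x z w v) u + G x (riem_curv G x z w w) z"
    unfolding \<Omega>_def linear_diff[OF op(1)] biv.simps op(3) by simp
  also have "bivector_inner (G x) \<Omega> \<Omega> = G x u u * G x v v - (G x u v)\<^sup>2 + (G x z z * G x w w - (G x z w)\<^sup>2)
      - 2 * (G x u z * G x v w - G x u w * G x v z)"
    unfolding \<Omega>_def biv.simps bivector_inner_wedge power2_eq_square
    using sym[of v u] sym[of w z] sym[of z u] sym[of z v] sym[of w u] sym[of w v] by (simp add: algebra_simps)
  finally show ?thesis .
qed

end

section \<open>Traces over orthonormal frames\<close>

context vec_inner_form
begin

text \<open>Expanding in \<open>e\<close> leaves sums over \<open>e'\<close> that Parseval contracts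
  to Kronecker deltas. It is needed for the frame formed by the vectors
  \<open>J (e i)\<close>.\<close>

lemma trace_frame_independent:
  fixes \<beta> :: "real^'n \<Rightarrow> real^'n \<Rightarrow> 'b::real_vector"
  assumes e: "orthonormal_frame k e" and e': "orthonormal_frame k e'" and \<beta>: "bilinear \<beta>"
  shows "(\<Sum>i\<in>UNIV. \<beta> (e' i) (e' i)) = (\<Sum>i\<in>UNIV. \<beta> (e i) (e i))"
proof -
  have "\<beta> u u = (\<Sum>a\<in>UNIV. \<Sum>b\<in>UNIV. (k u (e a) * k u (e b)) *\<^sub>R \<beta> (e a) (e b))" for u
    using bilinear_sum[OF \<beta>, of "\<lambda>i. k u (e i) *\<^sub>R e i" UNIV "\<lambda>i. k u (e i) *\<^sub>R e i" UNIV]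
    by (simp add: frame_expand[OF e, symmetric] sum.cartesian_product bilinear_lmul[OF \<beta>] bilinear_rmul[OF \<beta>] split_def mult.commute)
  then have "(\<Sum>i\<in>UNIV. \<beta> (e' i) (e' i))
    = (\<Sum>i\<in>UNIV. \<Sum>a\<in>UNIV. \<Sum>b\<in>UNIV. (k (e' i) (e a) * k (e' i) (e b)) *\<^sub>R \<beta> (e a) (e b))" by simp
  also have "\<dots> = (\<Sum>a\<in>UNIV. \<Sum>i\<in>UNIV. \<Sum>b\<in>UNIV. (k (e' i) (e a) * k (e' i) (e b)) *\<^sub>R \<beta> (e a) (e b))"
    by (rule sum.swap)
  also have "\<dots> = (\<Sum>a\<in>UNIV. \<Sum>b\<in>UNIV. \<Sum>i\<in>UNIV. (k (e' i) (e a) * k (e' i) (e b)) *\<^sub>R \<beta> (e a) (e b))"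
    by (rule sum.cong[OF refl], rule sum.swap)
  also have "\<dots> = (\<Sum>a\<in>UNIV. \<Sum>b\<in>UNIV. k (e a) (e b) *\<^sub>R \<beta> (e a) (e b))"
    unfolding frame_parseval[OF e', of "e _" "e _"] by (simp add: scaleR_sum_left sym)
  also have "\<dots> = (\<Sum>a\<in>UNIV. \<Sum>b\<in>UNIV. if a = b then \<beta> (e a) (e b) else 0)"
    by (intro sum.cong refl) (simp add: frameD[OF e])
  finally show ?thesis by simp
qed

text \<open>The algebraic part of the estimate, obtained by summing \<open>ineq\<close> over both
  indices. Inserting \<open>J\<close> in a traced slot does not change the trace, as
  \<open>J\<close> permutes orthonormal frames.\<close>

lemma complex_trace_bound:
  fixes \<alpha> :: "real^'n \<Rightarrow> real^'n \<Rightarrow> 'b::euclidean_space"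
  assumes e: "orthonormal_frame k e"
    and J: "linear J" "\<And>u. J (J u) = - u" "\<And>u v. k (J u) (J v) = k u v"
    and \<kappa>: "inner_form \<kappa>" and \<alpha>: "bilinear \<alpha>" "\<And>u v. \<alpha> u v = \<alpha> v u"
    and ineq: "\<And>a b. c * (2 * (1 - (if a = b then 1 else 0)) - 2 * (k (e a) (J (e b)))\<^sup>2)
      \<le> - \<kappa> (\<alpha> (e b) (e b)) (\<alpha> (e a) (e a)) + \<kappa> (\<alpha> (e a) (e b)) (\<alpha> (e a) (e b))
        + 2 * \<kappa> (\<alpha> (e b) (J (e b))) (\<alpha> (e a) (J (e a)))
        + \<kappa> (\<alpha> (e a) (J (e b))) (\<alpha> (e a) (J (e b))) + \<kappa> (\<alpha> (e b) (J (e a))) (\<alpha> (e b) (J (e a)))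
        - \<kappa> (\<alpha> (J (e b)) (J (e b))) (\<alpha> (J (e a)) (J (e a)))
        + \<kappa> (\<alpha> (J (e a)) (J (e b))) (\<alpha> (J (e a)) (J (e b)))"
  shows "c * (2 * (real CARD('n))\<^sup>2 - 4 * real CARD('n))
    \<le> 4 * (\<Sum>a\<in>UNIV. \<Sum>b\<in>UNIV. \<kappa> (\<alpha> (e a) (e b)) (\<alpha> (e a) (e b)))
      - 2 * \<kappa> (\<Sum>a\<in>UNIV. \<alpha> (e a) (e a)) (\<Sum>a\<in>UNIV. \<alpha> (e a) (e a))"
proof -
  interpret \<kappa>: inner_form \<kappa> by (rule \<kappa>)
  define N where "N u v = \<kappa> (\<alpha> u v) (\<alpha> u v)" for u v
  define S where "S = (\<Sum>a\<in>UNIV. \<Sum>b\<in>UNIV. N (e a) (e b))"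
  define T where "T = (\<Sum>a\<in>UNIV. \<alpha> (e a) (e a))"
  have Je: "orthonormal_frame k (\<lambda>i. J (e i))"
    using e by (simp add: orthonormal_frame_def J(3))
  note [simp] = linear_add[OF J(1)] linear_cmul[OF J(1)] bilinear_ladd[OF \<alpha>(1)] bilinear_radd[OF \<alpha>(1)]
    bilinear_lmul[OF \<alpha>(1)] bilinear_rmul[OF \<alpha>(1)] \<kappa>.simps
  have T: "(\<Sum>a\<in>UNIV. \<alpha> (J (e a)) (J (e a))) = T"
    unfolding T_def by (rule trace_frame_independent[OF e Je \<alpha>(1)])
  \<comment> \<open>Passing to the frame \<open>J (e a)\<close> turns each summand into
    \<open>- \<alpha> (J (e a)) (e a)\<close>, and symmetry of \<open>\<alpha>\<close> then gives
    \<open>P = - P\<close>.\<close>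
  define P where "P = (\<Sum>a\<in>UNIV. \<alpha> (e a) (J (e a)))"
  have "bilinear (\<lambda>u v. \<alpha> u (J v))"
    unfolding bilinear_def by (intro conjI allI linearI) simp_all
  from trace_frame_independent[OF e Je this]
  have "(\<Sum>a\<in>UNIV. \<alpha> (J (e a)) (- e a)) = P" by (simp add: J(2) P_def)
  then have "- P = P"
    using \<alpha>(2)[of "J _"] by (simp add: P_def bilinear_rneg[OF \<alpha>(1)] sum_negf)
  then have P: "P = 0" by (metis add.right_inverse scaleR_2 scaleR_eq_0_iff zero_neq_numeral)
  have N_sym: "N u v = N v u" for u v by (simp add: N_def \<alpha>(2)[of u v])
  have trN: "(\<Sum>b\<in>UNIV. N u (J (e b))) = (\<Sum>b\<in>UNIV. N u (e b))" for u
  proof -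
    have "bilinear (\<lambda>v w. \<kappa> (\<alpha> u v) (\<alpha> u w))"
      unfolding bilinear_def by (intro conjI allI linearI) simp_all
    from trace_frame_independent[OF e Je this] show ?thesis by (simp add: N_def)
  qed
  have S1: "(\<Sum>a\<in>UNIV. \<Sum>b\<in>UNIV. N (e a) (J (e b))) = S" by (simp add: S_def trN)
  have S2: "(\<Sum>a\<in>UNIV. \<Sum>b\<in>UNIV. N (e b) (J (e a))) = S" by (subst sum.swap) (rule S1)
  have S3: "(\<Sum>a\<in>UNIV. \<Sum>b\<in>UNIV. N (J (e a)) (J (e b))) = S"
    unfolding trN using S2 by (simp add: N_sym[of "J _"])
  have G: "(\<Sum>a\<in>UNIV. \<Sum>b\<in>UNIV. (k (e a) (J (e b)))\<^sup>2) = CARD('n)"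
  proof -
    have "(\<Sum>a\<in>UNIV. (k (e a) (J (e b)))\<^sup>2) = 1" for b
      using frame_parseval[OF e, of "J (e b)" "J (e b)"] frameD[OF e, of b b]
      by (simp add: J(3) power2_eq_square sym[of "J (e b)"])
    then show ?thesis by (subst sum.swap) simp
  qed
  have "(\<Sum>a\<in>UNIV. \<Sum>b\<in>UNIV. c * (2 * (1 - (if a = b then 1 else 0)) - 2 * (k (e a) (J (e b)))\<^sup>2))
    \<le> (\<Sum>a\<in>UNIV. \<Sum>b\<in>UNIV. - \<kappa> (\<alpha> (e b) (e b)) (\<alpha> (e a) (e a)) + N (e a) (e b)
        + 2 * \<kappa> (\<alpha> (e b) (J (e b))) (\<alpha> (e a) (J (e a)))
        + N (e a) (J (e b)) + N (e b) (J (e a))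
        - \<kappa> (\<alpha> (J (e b)) (J (e b))) (\<alpha> (J (e a)) (J (e a))) + N (J (e a)) (J (e b)))"
    unfolding N_def by (intro sum_mono ineq)
  also have "\<dots> = - \<kappa> T T + S + 2 * \<kappa> P P + S + S - \<kappa> T T + S"
  proof -
    have \<kappa>2: "(\<Sum>a\<in>UNIV. \<Sum>b\<in>UNIV. \<kappa> (f b) (f a)) = \<kappa> (\<Sum>a\<in>UNIV. f a) (\<Sum>a\<in>UNIV. f a)" for f :: "'n \<Rightarrow> 'b"
      by (simp add: \<kappa>.sum_left \<kappa>.sum_right)
    show ?thesis
      unfolding sum.distrib sum_subtractf sum_negf sum_distrib_left[symmetric] \<kappa>2 S1 S2 S3 T
        T_def[symmetric] S_def[symmetric] P_def[symmetric] by simp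
  qed
  also have "(\<Sum>a\<in>UNIV. \<Sum>b\<in>UNIV. c * (2 * (1 - (if a = b then 1 else 0)) - 2 * (k (e a) (J (e b)))\<^sup>2))
    = c * (2 * ((real CARD('n))\<^sup>2 - CARD('n)) - 2 * CARD('n))"
    unfolding sum_distrib_left[symmetric] sum_subtractf G by (simp add: power2_eq_square)
  finally show ?thesis unfolding T_def[symmetric] N_def[symmetric] S_def[symmetric] by (simp add: P algebra_simps)
qed

end

section \<open>The Gauss equation\<close>

locale chart_immersion = chart_map V K U F + dom: metric_chart U G
  for V :: "(real^'k::finite) set" and K and U :: "(real^'n::finite) set" and F and G +
  assumes isometric: "x \<in> U \<Longrightarrow> G x u v = K (F x) (ddir F x u) (ddir F x v)"
begin

text \<open>Metric compatibility of the ambient connection, written for the three derivatives in the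
  Koszul formula, and symmetry of \<open>cov\<close> determine the tangential part; this is the
  Koszul argument for uniqueness.\<close>

lemma cov_tangential:
  assumes x: "x \<in> U"
  shows "K (F x) (cov K F (\<lambda>y. ddir F y v) x u) (ddir F x z) = koszul G x u v z"
proof -
  interpret form: inner_form "K (F x)" by (rule inner_form[OF F_in[OF x]])
  have "ddir (\<lambda>y. G y v z) x u = K (F x) (cov K F (\<lambda>y. ddir F y v) x u) (ddir F x z)
      + K (F x) (ddir F x v) (cov K F (\<lambda>y. ddir F y z) x u)" for u v z
    using ddir_cong_open[OF open_U x, of "\<lambda>y. G y v z" "\<lambda>y. K (F y) (ddir F y v) (ddir F y z)"]
      cov_metric[OF x dF_diff[OF x] dF_diff[OF x]] isometric by simp
  then show ?thesis
    unfolding koszul_def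
    using cov_sym[OF x, of u v] cov_sym[OF x, of u z] cov_sym[OF x, of v z]
      form.sym[of "ddir F x v" "cov K F (\<lambda>y. ddir F y z) x u"]
      form.sym[of "ddir F x u" "cov K F (\<lambda>y. ddir F y z) x v"]
    by (simp add: form.sym[of "ddir F x u"])
qed

lemma second_ff_eq:
  assumes x: "x \<in> U"
  shows "second_ff K F x u v = cov K F (\<lambda>y. ddir F y v) x u - ddir F x (christoffel G x u v)"
    (is "_ = ?\<xi>")
proof -
  interpret form: inner_form "K (F x)" by (rule inner_form[OF F_in[OF x]])
  note lin = linear_ddir[OF F_diff[OF x]]
  let ?w = "cov K F (\<lambda>y. ddir F y v) x u"
  have 1: "K (F x) ?\<xi> (ddir F x z) = 0" for z
    by (simp add: form.simps cov_tangential[OF x] isometric[OF x, symmetric] dom.christoffel[OF x])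
  have "normal_component (K (F x)) (ddir F x) ?w = ?\<xi>"
    unfolding normal_component_def
  proof (rule the_equality)
    show "(\<forall>z. K (F x) ?\<xi> (ddir F x z) = 0) \<and> ?w - ?\<xi> \<in> range (ddir F x)" using 1 by simp
    fix \<xi> assume \<xi>: "(\<forall>z. K (F x) \<xi> (ddir F x z) = 0) \<and> ?w - \<xi> \<in> range (ddir F x)"
    then obtain t where t: "?w - \<xi> = ddir F x t" by blast
    \<comment> \<open>The difference of two candidates is tangent as well as normal, so it has
      length zero.\<close>
    have eq: "?\<xi> - \<xi> = ddir F x (t - christoffel G x u v)"
      using t linear_diff[OF lin] by (simp add: algebra_simps)
    have "K (F x) (?\<xi> - \<xi>) (?\<xi> - \<xi>) = 0"
      using \<xi> 1 unfolding form.simps(3)[of ?\<xi> \<xi>] by (simp add: eq)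
    then show "\<xi> = ?\<xi>" using form.pos[of "?\<xi> - \<xi>"] by auto
  qed
  then show ?thesis by (simp add: second_ff_def cov_def)
qed

lemma second_ff_normal: "x \<in> U \<Longrightarrow> K (F x) (second_ff K F x u v) (ddir F x z) = 0"
  by (simp add: second_ff_eq inner_form.simps[OF inner_form[OF F_in]] cov_tangential
      isometric[symmetric] dom.christoffel)

lemma second_ff_sym: "x \<in> U \<Longrightarrow> second_ff K F x u v = second_ff K F x v u"
  by (simp add: second_ff_eq cov_sym[of x u v] dom.christoffel_sym[of x u v])

text \<open>Linearity in the direction of differentiation is immediate; symmetry gives the other
  argument.\<close>

lemma bilinear_second_ff:
  assumes x: "x \<in> U"
  shows "bilinear (second_ff K F x)"
proof -
  note lin = linear_ddir[OF F_diff[OF x]]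
  have l: "linear (\<lambda>u. second_ff K F x u v)" for v
    unfolding second_ff_eq[OF x] cov_def
    using linear_ddir[OF dF_diff[OF x]]
    by (intro linearI) (simp_all add: linear_add linear_cmul lin algebra_simps
        bilinear_ladd[OF bilinear_christoffel[OF F_in[OF x]]] bilinear_lmul[OF bilinear_christoffel[OF F_in[OF x]]]
        bilinear_ladd[OF dom.bilinear_christoffel[OF x]] bilinear_lmul[OF dom.bilinear_christoffel[OF x]])
  moreover have "second_ff K F x u = (\<lambda>v. second_ff K F x v u)" for u
    by (rule ext) (rule second_ff_sym[OF x])
  ultimately show ?thesis unfolding bilinear_def by metis
qed

text \<open>\<open>cov_curvature\<close> for \<open>F\<close> and \<open>curvature_koszul\<close>
  for \<open>G\<close> share their derivative terms. Splitting \<open>cov\<close> into tangent and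
  normal parts, the mixed products vanish and the tangential ones are the Christoffel products of
  \<open>G\<close>.\<close>

lemma gauss:
  assumes x: "x \<in> U"
  shows "G x (riem_curv G x u v w) z =
    K (F x) (riem_curv K (F x) (ddir F x u) (ddir F x v) (ddir F x w)) (ddir F x z)
    + K (F x) (second_ff K F x v w) (second_ff K F x u z) - K (F x) (second_ff K F x u w) (second_ff K F x v z)"
proof -
  interpret form: inner_form "K (F x)" by (rule inner_form[OF F_in[OF x]])
  have D: "cov K F (\<lambda>y. ddir F y b) x a = second_ff K F x a b + ddir F x (christoffel G x a b)" for a b
    by (simp add: second_ff_eq[OF x])
  have DD: "K (F x) (cov K F (\<lambda>y. ddir F y b) x a) (cov K F (\<lambda>y. ddir F y q) x p)
    = K (F x) (second_ff K F x a b) (second_ff K F x p q) + G x (christoffel G x a b) (christoffel G x p q)" for a b p q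
    unfolding D using second_ff_normal[OF x] form.sym[of "ddir F x (christoffel G x a b)"]
    by (simp add: form.simps isometric[OF x])
  have "ddir (\<lambda>y. K (F y) (cov K F (\<lambda>y. ddir F y w) y b) (ddir F y z)) x a = ddir (\<lambda>y. koszul G y b w z) x a" for a b
    using ddir_cong_open[OF open_U x, of "\<lambda>y. K (F y) (cov K F (\<lambda>y. ddir F y w) y b) (ddir F y z)" "\<lambda>y. koszul G y b w z"]
      cov_tangential by simp
  then show ?thesis
    using cov_curvature[OF x, of w v z u] unfolding DD dom.curvature_koszul[OF x] by simp
qed

end

section \<open>Kaehler metrics\<close>

locale kaehler_chart = metric_chart U G
  for U :: "(real^'n::finite) set" and G +
  fixes J :: "real^'n \<Rightarrow> real^'n \<Rightarrow> real^'n"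
  assumes smooth_J: "smooth_on (\<lambda>x. J x u) U"
    and linear_J: "x \<in> U \<Longrightarrow> linear (J x)"
    and J_J: "x \<in> U \<Longrightarrow> J x (J x u) = - u"
    and J_isometric: "x \<in> U \<Longrightarrow> G x (J x u) (J x v) = G x u v"
    and J_parallel: "x \<in> U \<Longrightarrow>
      ddir (\<lambda>y. J y v) x u + christoffel G x u (J x v) - J x (christoffel G x u v) = 0"
begin

lemma cov_J:
  assumes x: "x \<in> U" and W: "W differentiable (at x)"
  shows "cov G (\<lambda>x. x) (\<lambda>y. J y (W y)) x u = J x (cov G (\<lambda>x. x) W x u)"
proof -
  have "ddir (\<lambda>y. J y (W y)) x u = ddir (\<lambda>y. J y (W x)) x u + J x (ddir W x u)"
    by (rule ddir_eqI, rule has_derivative_linear_family[OF open_dom x linear_J smooth_on_differentiable[OF smooth_J x] W])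
  then show ?thesis
    using J_parallel[OF x, of "W x" u] by (simp add: cov_def linear_add[OF linear_J[OF x]] algebra_simps)
qed

text \<open>By \<open>cov_J\<close> the covariant derivative commutes with \<open>J\<close>; the
  commutator formula is compared for the constant field \<open>w\<close> and for its image under
  \<open>J\<close>.\<close>

lemma curvature_J:
  assumes x: "x \<in> U"
  shows "riem_curv G x u v (J x w) = J x (riem_curv G x u v w)"
proof -
  have cov_const: "(\<lambda>y. cov G (\<lambda>x. x) (\<lambda>_. w) y v) differentiable (at x)" for v
    by (rule ident.cov_diff[OF x smooth_on_const])
  have "cov G (\<lambda>x. x) (\<lambda>y. cov G (\<lambda>x. x) (\<lambda>y. J y w) y v) x u
      = J x (cov G (\<lambda>x. x) (\<lambda>y. cov G (\<lambda>x. x) (\<lambda>_. w) y v) x u)" for u v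
  proof -
    have eq: "cov G (\<lambda>x. x) (\<lambda>y. J y w) y v = J y (cov G (\<lambda>x. x) (\<lambda>_. w) y v)" if "y \<in> U" for y
      by (rule cov_J[OF that differentiable_const])
    then have "cov G (\<lambda>x. x) (\<lambda>y. cov G (\<lambda>x. x) (\<lambda>y. J y w) y v) x u
      = cov G (\<lambda>x. x) (\<lambda>y. J y (cov G (\<lambda>x. x) (\<lambda>_. w) y v)) x u"
      by (rule cov_cong_open[OF open_dom x])
    also have "\<dots> = J x (cov G (\<lambda>x. x) (\<lambda>y. cov G (\<lambda>x. x) (\<lambda>_. w) y v) x u)"
      by (rule cov_J[OF x cov_const])
    finally show ?thesis .
  qed
  then show ?thesis
    using ident.cov_commutator[OF x smooth_J[of w], of v u] ident.cov_commutator[OF x smooth_on_const[of w], of v u]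
    by (simp flip: linear_diff[OF linear_J[OF x]])
qed

lemma J_skew:
  assumes x: "x \<in> U"
  shows "G x (J x u) v = - G x u (J x v)"
  using J_isometric[OF x, of "J x u" v] by (simp add: J_J[OF x] inner_form.simps[OF inner_form[OF x]])

text \<open>This invariance makes the intrinsic curvature cancel on u \<and> v - Ju \<and>
  Jv.\<close>

lemma curvature_form_J:
  "x \<in> U \<Longrightarrow> G x (riem_curv G x u v (J x w)) (J x z) = G x (riem_curv G x u v w) z"
  by (simp add: curvature_J J_isometric)

end

section \<open>Comparison with the function \<open>pinch\<close>\<close>

text \<open>For either parity \<open>pinch\<close> is at most
  \<open>2 * m * c + 4 * m * t\<^sup>2\<close>, with equality for even \<open>m\<close>, where
  \<open>n = 2 * p\<close> removes the root.\<close>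

lemma pinch_le:
  fixes t c :: real
  assumes m: "2 \<le> m" and t: "0 \<le> t" and tc: "0 \<le> t\<^sup>2 + c"
  shows "pinch (2 * m) (2 * (m div 2)) t c \<le> 2 * (real m)\<^sup>2 * t\<^sup>2 + 2 * real m * (real m - 1) * c"
proof -
  have main: "0 \<le> 2 * real m * ((real m - 2) * (t\<^sup>2 + c))" using m tc by simp
  show ?thesis
  proof (cases "even m")
    case True
    then have p: "2 * (m div 2) = m" by simp
    have "pinch (2 * m) (2 * (m div 2)) t c = 2 * real m * c + 4 * real m * t\<^sup>2"
      unfolding p pinch_def using m by (simp add: field_simps power2_eq_square power3_eq_cube)
    then show ?thesis using main by (simp add: algebra_simps power2_eq_square)
  next
    case False
    then have "2 * (m div 2) = m - 1" by presburger
    then have p: "real (2 * (m div 2)) = real m - 1" using m by simp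
    define M where "M = real m"
    have M: "2 \<le> M" using m by (simp add: M_def)
    define r where "r = sqrt (M\<^sup>2 * t\<^sup>2 + (M\<^sup>2 - 1) * c)"
    have M2: "0 < M\<^sup>2 - 1" using mult_mono[of 2 M 2 M] M by (simp add: power2_eq_square)
    \<comment> \<open>Here \<open>t\<^sup>2 + c \<ge> 0\<close> bounds the root below by
      \<open>t\<close>; replacing the root by \<open>t\<close> makes the denominator
      \<open>M\<^sup>2 - 1\<close> cancel.\<close>
    have "M\<^sup>2 * t\<^sup>2 + (M\<^sup>2 - 1) * c = t\<^sup>2 + (M\<^sup>2 - 1) * (t\<^sup>2 + c)" by (simp add: algebra_simps)
    then have "t\<^sup>2 \<le> M\<^sup>2 * t\<^sup>2 + (M\<^sup>2 - 1) * c" using M2 tc by simp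
    then have r: "t \<le> r" unfolding r_def by (rule real_le_rsqrt)
    have root: "sqrt ((2 * M)\<^sup>2 * t\<^sup>2 + 4 * (M - 1) * (2 * M - (M - 1)) * c) = 2 * r"
    proof -
      have "(2 * M)\<^sup>2 * t\<^sup>2 + 4 * (M - 1) * (2 * M - (M - 1)) * c = 4 * (M\<^sup>2 * t\<^sup>2 + (M\<^sup>2 - 1) * c)"
        by (simp add: algebra_simps power2_eq_square)
      then show ?thesis by (simp only: r_def real_sqrt_mult) simp
    qed
    have den: "2 * (M - 1) * (2 * M - (M - 1)) = 2 * (M\<^sup>2 - 1)"
      by (simp add: algebra_simps power2_eq_square)
    have "pinch (2 * m) (2 * (m div 2)) t c
      = 2 * M * c + (2 * M) ^ 3 * t\<^sup>2 / (2 * (M\<^sup>2 - 1)) - 2 * M * 2 * t / (2 * (M\<^sup>2 - 1)) * (2 * r)"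
    proof -
      have "\<bar>2 * M - 2 * (M - 1)\<bar> = 2" by simp
      then show ?thesis unfolding pinch_def p unfolding of_nat_mult of_nat_numeral M_def[symmetric] root den by simp
    qed
    also have "\<dots> = 2 * M * c + (4 * M ^ 3 * t\<^sup>2 - 4 * M * t * r) / (M\<^sup>2 - 1)"
    proof -
      have "(2 * M) ^ 3 * t\<^sup>2 / (2 * D) - 2 * M * 2 * t / (2 * D) * (2 * r) = (4 * M ^ 3 * t\<^sup>2 - 4 * M * t * r) / D" for D
        by (simp add: diff_divide_distrib power3_eq_cube)
      then show ?thesis by (simp only: add_diff_eq[symmetric])
    qed
    also have "\<dots> \<le> 2 * M * c + (4 * M ^ 3 * t\<^sup>2 - 4 * M * t * t) / (M\<^sup>2 - 1)"
      using M2 M t r by (intro add_left_mono divide_right_mono diff_left_mono mult_left_mono) auto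
    also have "(4 * M ^ 3 * t\<^sup>2 - 4 * M * t * t) / (M\<^sup>2 - 1) = 4 * M * t\<^sup>2"
    proof -
      have "4 * M ^ 3 * t\<^sup>2 - 4 * M * t * t = 4 * M * t\<^sup>2 * (M\<^sup>2 - 1)"
        by (simp add: algebra_simps power2_eq_square power3_eq_cube)
      then show ?thesis using M2 by simp
    qed
    finally show ?thesis using main unfolding M_def[symmetric] by (simp add: algebra_simps power2_eq_square)
  qed
qed

section \<open>The estimate for a Kaehler immersion in charts\<close>

locale kaehler_immersion = chart_immersion V K U F G + kaehler: kaehler_chart U G J
  for V :: "(real^'k::finite) set" and K and U :: "(real^'n::finite) set" and F and G and J
begin

lemma second_ff_trace_bound:
  assumes x: "x \<in> U" and e: "orthonormal_frame (G x) e"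
    and ev: "\<forall>ev. (\<exists>B\<in>bivectors. B \<noteq> 0 \<and> curvature_operator K (F x) B = ev *\<^sub>R B) \<longrightarrow> c \<le> ev"
  shows "c * (2 * (real CARD('n))\<^sup>2 - 4 * real CARD('n))
    \<le> 4 * (\<Sum>a\<in>UNIV. \<Sum>b\<in>UNIV. K (F x) (second_ff K F x (e a) (e b)) (second_ff K F x (e a) (e b)))
      - 2 * K (F x) (\<Sum>a\<in>UNIV. second_ff K F x (e a) (e a)) (\<Sum>a\<in>UNIV. second_ff K F x (e a) (e a))"
proof -
  interpret src: vec_inner_form "G x" by (rule dom.vec_inner_form[OF x])
  interpret form: inner_form "K (F x)" by (rule inner_form[OF F_in[OF x]])
  note sym = second_ff_sym[OF x]
  let ?J = "J x" and ?\<alpha> = "second_ff K F x"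
  let ?R = "\<lambda>u v w z. G x (riem_curv G x u v w) z"
  have skew: "G x (?J u) v = - G x u (?J v)" for u v by (rule kaehler.J_skew[OF x])
  have J0: "G x u (?J u) = 0" for u
    using skew[of u u] src.sym[of u "?J u"] by simp
  have gauss': "K (F x) (riem_curv K (F x) (ddir F x u) (ddir F x v) (ddir F x w)) (ddir F x z)
    = ?R u v w z - K (F x) (?\<alpha> v w) (?\<alpha> u z) + K (F x) (?\<alpha> u w) (?\<alpha> v z)" for u v w z
    using gauss[OF x, of u v w z] by simp
  have ineq: "c * (2 * (1 - (if a = b then 1 else 0)) - 2 * (G x (e a) (?J (e b)))\<^sup>2)
      \<le> - K (F x) (?\<alpha> (e b) (e b)) (?\<alpha> (e a) (e a)) + K (F x) (?\<alpha> (e a) (e b)) (?\<alpha> (e a) (e b))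
        + 2 * K (F x) (?\<alpha> (e b) (?J (e b))) (?\<alpha> (e a) (?J (e a)))
        + K (F x) (?\<alpha> (e a) (?J (e b))) (?\<alpha> (e a) (?J (e b))) + K (F x) (?\<alpha> (e b) (?J (e a))) (?\<alpha> (e b) (?J (e a)))
        - K (F x) (?\<alpha> (?J (e b)) (?J (e b))) (?\<alpha> (?J (e a)) (?J (e a)))
        + K (F x) (?\<alpha> (?J (e a)) (?J (e b))) (?\<alpha> (?J (e a)) (?J (e b)))" for a b
  proof -
    define u v where "u = e a" and "v = e b"
    have fr: "G x u u = 1" "G x v v = 1" "(G x u v)\<^sup>2 = (if a = b then 1 else 0)"
      by (simp_all add: u_def v_def src.frameD[OF e])
    have g2: "G x u (?J v) * G x v (?J u) = - (G x u (?J v))\<^sup>2"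
      using skew[of u v] src.sym[of "?J u" v] by (simp add: power2_eq_square)
    have lhs: "c * (2 * (1 - (if a = b then 1 else 0)) - 2 * (G x u (?J v))\<^sup>2)
      = c * (G x u u * G x v v - (G x u v)\<^sup>2 + (G x (?J u) (?J u) * G x (?J v) (?J v) - (G x (?J u) (?J v))\<^sup>2)
        - 2 * (G x u (?J u) * G x v (?J v) - G x u (?J v) * G x v (?J u)))"
      by (simp add: kaehler.J_isometric[OF x] fr J0 g2)
    \<comment> \<open>By these two equations the four intrinsic curvature terms cancel, and only the
      second fundamental form is left.\<close>
    have curv: "?R u v (?J v) (?J u) = ?R u v v u" "?R (?J u) (?J v) (?J v) (?J u) = ?R (?J u) (?J v) v u"
      by (rule kaehler.curvature_form_J[OF x])+
    \<comment> \<open>The squared length of \<open>?\<alpha> u (?J v) + ?\<alpha> v (?J u)\<close>;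
      it replaces the mixed product, which has no definite sign, by two squares whose sums are
      known.\<close>
    have cs: "0 \<le> K (F x) (?\<alpha> u (?J v)) (?\<alpha> u (?J v)) + 2 * K (F x) (?\<alpha> u (?J v)) (?\<alpha> v (?J u))
        + K (F x) (?\<alpha> v (?J u)) (?\<alpha> v (?J u))"
      using form.nonneg[of "?\<alpha> u (?J v) + ?\<alpha> v (?J u)"] form.sym[of "?\<alpha> u (?J v)" "?\<alpha> v (?J u)"]
      by (simp add: form.simps)
    have "c * (2 * (1 - (if a = b then 1 else 0)) - 2 * (G x u (?J v))\<^sup>2)
      \<le> - K (F x) (?\<alpha> v v) (?\<alpha> u u) + K (F x) (?\<alpha> u v) (?\<alpha> u v)
        + 2 * K (F x) (?\<alpha> v (?J v)) (?\<alpha> u (?J u)) - 2 * K (F x) (?\<alpha> u (?J v)) (?\<alpha> v (?J u))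
        - K (F x) (?\<alpha> (?J v) (?J v)) (?\<alpha> (?J u) (?J u)) + K (F x) (?\<alpha> (?J u) (?J v)) (?\<alpha> (?J u) (?J v))"
      using curvature_wedge_diff_ge[OF F_in[OF x] ev, where u = "ddir F x u" and v = "ddir F x v"
          and z = "ddir F x (?J u)" and w = "ddir F x (?J v)"]
      unfolding isometric[OF x, symmetric] gauss' curv lhs
      using sym[of v u] sym[of "?J v" v] sym[of "?J u" u] sym[of "?J v" u] sym[of "?J u" v] sym[of "?J v" "?J u"]
        form.sym[of "?\<alpha> v (?J u)" "?\<alpha> u (?J v)"]
      by simp
    then show ?thesis using cs unfolding u_def v_def by linarith
  qed
  show ?thesis
    by (rule src.complex_trace_bound[where J = ?J and \<kappa> = "K (F x)" and \<alpha> = ?\<alpha>,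
        OF e kaehler.linear_J[OF x] kaehler.J_J[OF x] kaehler.J_isometric[OF x]
        inner_form[OF F_in[OF x]] bilinear_second_ff[OF x] sym ineq])
qed

lemma sff_sq_length_bound:
  assumes x: "x \<in> U"
    and ev: "\<forall>ev. (\<exists>B\<in>bivectors. B \<noteq> 0 \<and> curvature_operator K (F x) B = ev *\<^sub>R B) \<longrightarrow> c \<le> ev"
    and n: "CARD('n) = 2 * m"
  shows "2 * (real m)\<^sup>2 * K (F x) (mean_curvature_vector G K F x) (mean_curvature_vector G K F x)
      + 2 * real m * (real m - 1) * c \<le> sff_sq_length G K F x"
proof -
  interpret src: vec_inner_form "G x" by (rule dom.vec_inner_form[OF x])
  interpret form: inner_form "K (F x)" by (rule inner_form[OF F_in[OF x]])
  \<comment> \<open>The squared length and the mean curvature vector are defined with this same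
    \<open>SOME\<close> term, so one frame serves both.\<close>
  define e where "e = (SOME e. orthonormal_frame (G x) e)"
  have e: "orthonormal_frame (G x) e" unfolding e_def by (rule someI_ex[OF src.ex_orthonormal_frame])
  let ?T = "\<Sum>a\<in>UNIV. second_ff K F x (e a) (e a)"
  have m: "real m \<noteq> 0" using n by (metis finite_UNIV_card_ge_0 finite_code less_irrefl mult_0_right of_nat_eq_0_iff)
  have S: "sff_sq_length G K F x
    = (\<Sum>a\<in>UNIV. \<Sum>b\<in>UNIV. K (F x) (second_ff K F x (e a) (e b)) (second_ff K F x (e a) (e b)))"
    unfolding sff_sq_length_def Let_def e_def ..
  have H: "mean_curvature_vector G K F x = (1 / (2 * real m)) *\<^sub>R ?T"
    unfolding mean_curvature_vector_def Let_def e_def n by simp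
  have "2 * (real m)\<^sup>2 * K (F x) (mean_curvature_vector G K F x) (mean_curvature_vector G K F x) = K (F x) ?T ?T / 2"
    unfolding H form.simps using m by (simp add: power2_eq_square)
  moreover have "c * (2 * (real CARD('n))\<^sup>2 - 4 * real CARD('n)) = 4 * (2 * real m * (real m - 1) * c)"
    unfolding n by (simp add: algebra_simps power2_eq_square)
  moreover have "c * (2 * (real CARD('n))\<^sup>2 - 4 * real CARD('n)) \<le> 4 * sff_sq_length G K F x - 2 * K (F x) ?T ?T"
    unfolding S by (rule second_ff_trace_bound[OF x e ev])
  ultimately show ?thesis by linarith
qed

end

section \<open>Charts\<close>

lemma chart_at_mem:
  assumes "smooth_manifold X A" "p \<in> topspace X"
  shows "chart_at A p \<in> A" "p \<in> fst (chart_at A p)"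
proof -
  have "\<exists>\<kappa>. \<kappa> \<in> A \<and> p \<in> fst \<kappa>" using assms by (auto simp: smooth_manifold_def)
  from someI_ex[OF this] show "chart_at A p \<in> A" "p \<in> fst (chart_at A p)"
    unfolding chart_at_def by blast+
qed

lemma chart_inv_coords:
  assumes "smooth_manifold X A" "\<kappa> \<in> A" "p \<in> fst \<kappa>"
  shows "chart_inv \<kappa> (snd \<kappa> p) = p"
proof -
  have "homeomorphic_map (subtopology X (fst \<kappa>)) (top_of_set (chart_image \<kappa>)) (snd \<kappa>)"
    and op: "openin X (fst \<kappa>)"
    using assms by (auto simp: smooth_manifold_def)
  then have "inj_on (snd \<kappa>) (topspace (subtopology X (fst \<kappa>)))"
    by (simp add: homeomorphic_map_def homeomorphic_eq_everything_map)
  then have "inj_on (snd \<kappa>) (fst \<kappa>)"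
    using openin_subset[OF op] by (simp add: Int_absorb1)
  then show ?thesis unfolding chart_inv_def using assms(3) by simp
qed

lemma open_local_dom:
  assumes X: "smooth_manifold X A" and Y: "smooth_manifold Y B" and f: "continuous_map X Y f"
    and \<kappa>: "\<kappa> \<in> A" and \<mu>: "\<mu> \<in> B"
  shows "open (local_dom \<kappa> \<mu> f)"
proof -
  have h: "homeomorphic_map (subtopology X (fst \<kappa>)) (top_of_set (chart_image \<kappa>)) (snd \<kappa>)"
    and op: "openin X (fst \<kappa>)" and im: "open (chart_image \<kappa>)" and op': "openin Y (fst \<mu>)"
    using X Y \<kappa> \<mu> by (auto simp: smooth_manifold_def)
  have "openin X {p \<in> topspace X. f p \<in> fst \<mu>}" by (rule openin_continuous_map_preimage[OF f op'])
  moreover have "{p \<in> fst \<kappa>. f p \<in> fst \<mu>} = {p \<in> topspace X. f p \<in> fst \<mu>} \<inter> fst \<kappa>"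
    using openin_subset[OF op] by auto
  ultimately have "openin (subtopology X (fst \<kappa>)) {p \<in> fst \<kappa>. f p \<in> fst \<mu>}"
    by (auto simp: openin_subtopology)
  then have "openin (top_of_set (chart_image \<kappa>)) (local_dom \<kappa> \<mu> f)"
    unfolding local_dom_def using homeomorphic_imp_open_map[OF h] by (auto simp: open_map_def)
  then show ?thesis using im by (meson openin_open_trans)
qed

lemma metric_chart_of_metric:
  assumes "smooth_manifold X A" "riemannian_metric A g" "\<kappa> \<in> A"
  shows "metric_chart (chart_image \<kappa>) (g \<kappa>)"
proof (rule metric_chart.intro)
  show "open (chart_image \<kappa>)" using assms by (auto simp: smooth_manifold_def)
  show "inner_form (g \<kappa> x)" if "x \<in> chart_image \<kappa>" for x
    using assms(2,3) that by unfold_locales (auto simp: riemannian_metric_def)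
  show "smooth_on (\<lambda>x. g \<kappa> x u v) (chart_image \<kappa>)" for u v
    using assms(2,3) by (auto simp: riemannian_metric_def)
qed

lemma local_dom_subset: "local_dom \<kappa> \<mu> f \<subseteq> chart_image \<kappa>"
  by (auto simp: local_dom_def chart_image_def)

theorem corollary3:
  fixes m :: nat and c :: real
    and X :: "'a topology" and A :: "('a, 'n::finite) chart set"
    and g :: "('a, 'n) chart \<Rightarrow> real^'n \<Rightarrow> real^'n \<Rightarrow> real^'n \<Rightarrow> real"
    and J :: "('a, 'n) chart \<Rightarrow> real^'n \<Rightarrow> real^'n \<Rightarrow> real^'n"
    and Y :: "'b topology" and B :: "('b, 'k::finite) chart set"
    and h :: "('b, 'k) chart \<Rightarrow> real^'k \<Rightarrow> real^'k \<Rightarrow> real^'k \<Rightarrow> real"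
    and f :: "'a \<Rightarrow> 'b"
  assumes "2 \<le> m" and "CARD('n) = 2 * m"
    and "kaehler_manifold X A g J" and "oriented_atlas A"
    and "riemannian_manifold Y B h"
    and "isometric_immersion X A g Y B h f"
    and "curvature_operator_bounded_below B h c"
    and "\<forall>p\<in>topspace X. (H_fun A g B h f p)\<^sup>2 + c \<ge> 0"
  shows "\<forall>p\<in>topspace X.
           S_fun A g B h f p \<ge> pinch (2 * m) (2 * (m div 2)) (H_fun A g B h f p) c"
proof
  fix p assume p: "p \<in> topspace X"
  have X: "smooth_manifold X A" and g: "riemannian_metric A g"
    and Y: "smooth_manifold Y B" and h: "riemannian_metric B h"
    using assms(3,5) by (auto simp: kaehler_manifold_def riemannian_manifold_def)
  have f: "continuous_map X Y f"
    and smooth_f: "\<And>\<kappa> \<mu>. \<kappa> \<in> A \<Longrightarrow> \<mu> \<in> B \<Longrightarrow> smooth_on (local_rep \<kappa> \<mu> f) (local_dom \<kappa> \<mu> f)"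
    using assms(6) by (auto simp: isometric_immersion_def smooth_map_def)
  have fp: "f p \<in> topspace Y" using f p by (auto simp: continuous_map_def)
  define \<kappa> \<mu> where "\<kappa> = chart_at A p" and "\<mu> = chart_at B (f p)"
  have \<kappa>: "\<kappa> \<in> A" "p \<in> fst \<kappa>" and \<mu>: "\<mu> \<in> B" "f p \<in> fst \<mu>"
    unfolding \<kappa>_def \<mu>_def using chart_at_mem[OF X p] chart_at_mem[OF Y fp] by auto
  define F where "F = local_rep \<kappa> \<mu> f"
  \<comment> \<open>On this smaller domain \<open>F\<close> takes values in the single ambient chart
    \<open>\<mu>\<close>; the metric and \<open>J\<close> are restricted to it below.\<close>
  define U where "U = local_dom \<kappa> \<mu> f"
  define x where "x = snd \<kappa> p"
  have F: "F (snd \<kappa> q) = snd \<mu> (f q)" if "q \<in> fst \<kappa>" for q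
    by (simp add: F_def local_rep_def chart_inv_coords[OF X \<kappa>(1) that])
  have x: "x \<in> U" unfolding x_def U_def local_dom_def using \<kappa>(2) \<mu>(2) by auto
  have U: "U \<subseteq> chart_image \<kappa>" unfolding U_def by (rule local_dom_subset)
  interpret ambient: metric_chart "chart_image \<mu>" "h \<mu>"
    by (rule metric_chart_of_metric[OF Y h \<mu>(1)])
  interpret whole: metric_chart "chart_image \<kappa>" "g \<kappa>"
    by (rule metric_chart_of_metric[OF X g \<kappa>(1)])
  have open_U: "open U" unfolding U_def by (rule open_local_dom[OF X Y f \<kappa>(1) \<mu>(1)])
  have kaehler: "smooth_on (\<lambda>x. J \<kappa> x u) (chart_image \<kappa>)"
    "y \<in> chart_image \<kappa> \<Longrightarrow> linear (J \<kappa> y)"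
    "y \<in> chart_image \<kappa> \<Longrightarrow> J \<kappa> y (J \<kappa> y u) = - u"
    "y \<in> chart_image \<kappa> \<Longrightarrow> g \<kappa> y (J \<kappa> y u) (J \<kappa> y v) = g \<kappa> y u v"
    "y \<in> chart_image \<kappa> \<Longrightarrow> ddir (\<lambda>z. J \<kappa> z v) y u + christoffel (g \<kappa>) y u (J \<kappa> y v)
      - J \<kappa> y (christoffel (g \<kappa>) y u v) = 0" for y u v
    using assms(3) \<kappa>(1) unfolding kaehler_manifold_def by blast+
  have dom: "metric_chart U (g \<kappa>)"
    using open_U U whole.inner_form smooth_on_subset[OF whole.smooth U] by (intro metric_chart.intro) auto
  have F_in: "F y \<in> chart_image \<mu>" if "y \<in> U" for y
    using that F by (auto simp: U_def local_dom_def chart_image_def)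
  have "smooth_on F U" unfolding F_def U_def by (rule smooth_f[OF \<kappa>(1) \<mu>(1)])
  then have map: "chart_map (chart_image \<mu>) (h \<mu>) U F"
    using open_U F_in by (intro chart_map.intro ambient.metric_chart_axioms chart_map_axioms.intro)
  have "g \<kappa> y u v = h \<mu> (F y) (ddir F y u) (ddir F y v)" if "y \<in> U" for y u v
    using assms(6) \<kappa>(1) \<mu>(1) that unfolding isometric_immersion_def F_def U_def by blast
  then have imm: "chart_immersion (chart_image \<mu>) (h \<mu>) U F (g \<kappa>)"
    by (intro chart_immersion.intro map dom chart_immersion_axioms.intro)
  have "kaehler_chart U (g \<kappa>) (J \<kappa>)"
    using U kaehler by (intro kaehler_chart.intro dom kaehler_chart_axioms.intro smooth_on_subset[OF kaehler(1) U]) auto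
  with imm interpret kaehler_immersion "chart_image \<mu>" "h \<mu>" U F "g \<kappa>" "J \<kappa>"
    by (rule kaehler_immersion.intro)
  define t where "t = H_fun A g B h f p"
  define \<eta> where "\<eta> = mean_curvature_vector (g \<kappa>) (h \<mu>) F x"
  have Fx: "F x = snd \<mu> (f p)" unfolding x_def by (rule F[OF \<kappa>(2)])
  have "0 \<le> h \<mu> (F x) \<eta> \<eta>" by (rule inner_form.nonneg[OF ambient.inner_form[OF F_in[OF x]]])
  moreover have tH: "t = sqrt (h \<mu> (F x) \<eta> \<eta>)"
    unfolding Fx by (simp add: t_def H_fun_def Let_def \<eta>_def x_def F_def \<kappa>_def \<mu>_def)
  ultimately have t: "0 \<le> t" "t\<^sup>2 = h \<mu> (F x) \<eta> \<eta>" by auto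
  have S: "S_fun A g B h f p = sff_sq_length (g \<kappa>) (h \<mu>) F x"
    by (simp add: S_fun_def Let_def x_def F_def \<kappa>_def \<mu>_def)
  have ev: "\<forall>ev. (\<exists>C\<in>bivectors. C \<noteq> 0 \<and> curvature_operator (h \<mu>) (F x) C = ev *\<^sub>R C) \<longrightarrow> c \<le> ev"
    using assms(7) \<mu>(1) F_in[OF x] unfolding curvature_operator_bounded_below_def by blast
  have "2 * (real m)\<^sup>2 * t\<^sup>2 + 2 * real m * (real m - 1) * c \<le> S_fun A g B h f p"
    unfolding t(2) S \<eta>_def by (rule sff_sq_length_bound[OF x ev assms(2)])
  moreover have "0 \<le> t\<^sup>2 + c" using assms(8) p by (simp add: t_def)
  ultimately show "pinch (2 * m) (2 * (m div 2)) (H_fun A g B h f p) c \<le> S_fun A g B h f p"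
    using pinch_le[OF assms(1) t(1), of c] by (simp add: t_def)
qed

end
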